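(* Let $d\ge1$ and let $\mathbb V=(V_x)_{x\in\mathbb Z^d}$ be i.i.d. random variables with $\operatorname{ess\,inf}V_x=0$, $\mathbb E V_x^d<\infty$ and $\mathbb P[V_x=0]<1$. Suppose $h>0$ and $0\le\beta_0<\beta_{\mathrm c}^{\mathrm{an}}(h)$, and let $K_{h,\beta_0}<\infty$ be a constant such that $$Z^{\mathrm{an}}_{h,\beta,N}\ge\frac{\exp(-m^{\mathrm{an}}(h,\beta)N)}{K_{h,\beta_0}}\qquad\text{for all }N\in\mathbb N,\ 0\le\beta\le\beta_0 .$$ Then for any $\varepsilon<1/K_{h,\beta_0}$ there exists $k_\varepsilon<\infty$ such that $$\mathbb E Z^{\mathrm{qu}}_{\mathbb V,h,\beta,k_\varepsilon,N}\ge\varepsilon Z^{\mathrm{an}}_{h,\beta,N}$$ for all $N\in\mathbb N$ and $0\le\beta\le\beta_0$.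
   Context: $\mathbb N=\{1,2,\dots\}$. For $h\ge0$, $P_h$ (expectation $E_h$) is the law of the nearest-neighbor random walk $S=(S(n))_{n\ge0}$ on $\mathbb Z^d$ with $S(0)=0$ and i.i.d. increments satisfying $P_h[S(1)=e]=e^{h e_1}/\sum_{e'}e^{he'_1}$ for each of the $2d$ unit vectors $e$ (sum over the same unit vectors; $e_1$ is the first coordinate of $e$). $S_1$ is the first component of $S$. The potential $\mathbb V$ (probability $\mathbb P$, expectation $\mathbb E$) is independent of the walk. Local times: $\ell_x(N)=\sum_{n=1}^N1_{\{S(n)=x\}}$. Modified quenched partition function, for $k\ge0$: $Z^{\mathrm{qu}}_{\mathbb V,h,\beta,k,N}=E_h\big[e^{-\beta\sum_{x}\ell_x(N)V_x};\ \sum_{x\in\mathbb Z^d}\ell_x(N)^2\le kN\big]$. Annealed quantities: $\varphi^{\mathrm{an}}_\beta(t)=-\log\mathbb E\exp(-t\beta V_x)$, $\Phi^{\mathrm{an}}_\beta(N)=\sum_{x}\varphi^{\mathrm{an}}_\beta(\ell_x(N))$, $Z^{\mathrm{an}}_{h,\beta,N}=E_h[\exp(-\Phi^{\mathrm{an}}_\beta(N))]=\mathbb E E_h[e^{-\beta\sum_{x}\ell_x(N)V_x}]$, and $m^{\mathrm{an}}(h,\beta)=-\lim_{N\to\infty}\frac1N\log Z^{\mathrm{an}}_{h,\beta,N}$ (the limit exists). Critical parameter: for $h>0$ let $\overline m^{\mathrm{an}}(h,\beta)=-\lim_{L\to\infty}\frac1L\log\sum_{n=1}^\infty E_h[\exp(-\Phi^{\mathrm{an}}_\beta(n));\{S_1(n)=L\}]$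 (the limit exists), extended continuously in $h$ to $h=0$. For $h>0$, $\beta_{\mathrm c}^{\mathrm{an}}(h)>0$ is the unique number with $\overline m^{\mathrm{an}}(0,\beta_{\mathrm c}^{\mathrm{an}}(h))=h$. *)

theory Defs
  imports "HOL-Probability.Probability"
begin

text \<open>
  The lattice is \<open>int ^ 'd\<close>, so the dimension is \<open>CARD('d)\<close>.  The index type carries no order;
  the index \<open>\<iota>\<close> of the coordinate called the first one is therefore a parameter, and it is
  arbitrary in the theorem.
\<close>

section \<open>The random walk\<close>

definition unit_vectors :: "(int ^ 'd::finite) set" where
  "unit_vectors = {axis j s | j s. s = 1 \<or> s = - 1}"

definition step_weight :: "'d::finite \<Rightarrow> real \<Rightarrow> int ^ 'd \<Rightarrow> real" where
  "step_weight \<iota> h e =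
     (if e \<in> unit_vectors
      then exp (h * real_of_int (e $ \<iota>)) / (\<Sum>e'\<in>unit_vectors. exp (h * real_of_int (e' $ \<iota>)))
      else 0)"

definition step_pmf :: "'d::finite \<Rightarrow> real \<Rightarrow> (int ^ 'd) pmf" where
  "step_pmf \<iota> h = embed_pmf (step_weight \<iota> h)"

lemma finite_unit_vectors: "finite (unit_vectors :: (int ^ 'd::finite) set)"
proof -
  have "unit_vectors = (\<lambda>(j, s). axis j s) ` ((UNIV :: 'd set) \<times> {1, - 1 :: int})"
    by (auto simp: unit_vectors_def)
  moreover have "finite ((\<lambda>(j, s). axis j s) ` ((UNIV :: 'd set) \<times> {1, - 1 :: int}))"
    by (intro finite_imageI finite_cartesian_product) auto
  ultimately show ?thesis by (rule ssubst)
qed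

lemma unit_vectors_nonempty: "(unit_vectors :: (int ^ 'd::finite) set) \<noteq> {}"
  by (auto simp: unit_vectors_def)

lemma pmf_step_pmf: "pmf (step_pmf \<iota> h) e = step_weight \<iota> h e"
proof -
  let ?U = "unit_vectors :: (int ^ 'd) set"
  let ?Z = "\<Sum>e'\<in>?U. exp (h * real_of_int (e' $ \<iota>))"
  have Z: "?Z > 0"
    by (intro sum_pos finite_unit_vectors unit_vectors_nonempty) simp
  have nn: "step_weight \<iota> h x \<ge> 0" for x
    using Z by (simp add: step_weight_def)
  have "(\<integral>\<^sup>+ x. ennreal (step_weight \<iota> h x) \<partial>count_space UNIV) =
        (\<Sum>x\<in>?U. ennreal (step_weight \<iota> h x))"
    by (rule nn_integral_count_space'[OF finite_unit_vectors]) (auto simp: step_weight_def)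
  also have "\<dots> = ennreal (\<Sum>x\<in>?U. step_weight \<iota> h x)"
    by (simp add: nn)
  also have "(\<Sum>x\<in>?U. step_weight \<iota> h x) = (\<Sum>x\<in>?U. exp (h * real_of_int (x $ \<iota>)) / ?Z)"
    by (intro sum.cong) (auto simp: step_weight_def)
  also have "\<dots> = 1"
    using Z by (simp add: sum_divide_distrib[symmetric])
  finally show ?thesis
    unfolding step_pmf_def by (intro pmf_embed_pmf nn) simp
qed

text \<open>
  The walk is realised on the space of its increments: \<open>walk_law \<iota> h\<close> makes them i.i.d., and
  \<open>walk \<xi> n\<close> is the position \<open>S(n)\<close> when \<open>\<xi> m\<close> is the increment from time \<open>m\<close> to time \<open>m + 1\<close>.
\<close>

definition walk_law :: "'d::finite \<Rightarrow> real \<Rightarrow> (nat \<Rightarrow> int ^ 'd) measure" where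
  "walk_law \<iota> h = (\<Pi>\<^sub>M _\<in>UNIV. measure_pmf (step_pmf \<iota> h))"

definition walk :: "(nat \<Rightarrow> int ^ 'd::finite) \<Rightarrow> nat \<Rightarrow> int ^ 'd" where
  "walk \<xi> n = (\<Sum>m<n. \<xi> m)"

definition local_time :: "(nat \<Rightarrow> int ^ 'd::finite) \<Rightarrow> nat \<Rightarrow> int ^ 'd \<Rightarrow> nat" where
  "local_time \<xi> N x = card {n \<in> {1..N}. walk \<xi> n = x}"

section \<open>The potential\<close>

definition ess_inf :: "'a measure \<Rightarrow> ('a \<Rightarrow> real) \<Rightarrow> ereal" where
  "ess_inf M f = Sup {z. AE \<omega> in M. z \<le> ereal (f \<omega>)}"

section \<open>Quenched and annealed quantities\<close>

text \<open>
  The sums over all of \<open>int ^ 'd\<close> below have only finitely many nonzero terms.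
\<close>

definition Z_qu :: "'d::finite \<Rightarrow> (int ^ 'd \<Rightarrow> real) \<Rightarrow> real \<Rightarrow> real \<Rightarrow> real \<Rightarrow> nat \<Rightarrow> real" where
  "Z_qu \<iota> v h \<beta> k N =
     (LINT \<xi>:{\<xi>. (\<Sum>\<^sub>\<infinity>x. (real (local_time \<xi> N x))\<^sup>2) \<le> k * real N}|walk_law \<iota> h.
        exp (- \<beta> * (\<Sum>\<^sub>\<infinity>x. real (local_time \<xi> N x) * v x)))"

text \<open>
  The potential is identically distributed, so the annealed potential may be read off at the site 0.
\<close>

definition phi_an :: "'a measure \<Rightarrow> (int ^ 'd::finite \<Rightarrow> 'a \<Rightarrow> real) \<Rightarrow> real \<Rightarrow> real \<Rightarrow> real" where
  "phi_an M V \<beta> t = - ln (LINT \<omega>|M. exp (- t * \<beta> * V 0 \<omega>))"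

definition Phi_an ::
  "'a measure \<Rightarrow> (int ^ 'd::finite \<Rightarrow> 'a \<Rightarrow> real) \<Rightarrow> real \<Rightarrow> nat \<Rightarrow> (nat \<Rightarrow> int ^ 'd) \<Rightarrow> real" where
  "Phi_an M V \<beta> N \<xi> = (\<Sum>\<^sub>\<infinity>x. phi_an M V \<beta> (real (local_time \<xi> N x)))"

definition Z_an ::
  "'a measure \<Rightarrow> (int ^ 'd::finite \<Rightarrow> 'a \<Rightarrow> real) \<Rightarrow> 'd \<Rightarrow> real \<Rightarrow> real \<Rightarrow> nat \<Rightarrow> real" where
  "Z_an M V \<iota> h \<beta> N = (LINT \<xi>|walk_law \<iota> h. exp (- Phi_an M V \<beta> N \<xi>))"

definition m_an ::
  "'a measure \<Rightarrow> (int ^ 'd::finite \<Rightarrow> 'a \<Rightarrow> real) \<Rightarrow> 'd \<Rightarrow> real \<Rightarrow> real \<Rightarrow> real" where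
  "m_an M V \<iota> h \<beta> = - lim (\<lambda>N. ln (Z_an M V \<iota> h \<beta> N) / real N)"

definition mbar_an_pos ::
  "'a measure \<Rightarrow> (int ^ 'd::finite \<Rightarrow> 'a \<Rightarrow> real) \<Rightarrow> 'd \<Rightarrow> real \<Rightarrow> real \<Rightarrow> real" where
  "mbar_an_pos M V \<iota> h \<beta> =
     - lim (\<lambda>L. ln (\<Sum>n. LINT \<xi>:{\<xi>. walk \<xi> (Suc n) $ \<iota> = int L}|walk_law \<iota> h.
                        exp (- Phi_an M V \<beta> (Suc n) \<xi>)) / real L)"

definition mbar_an ::
  "'a measure \<Rightarrow> (int ^ 'd::finite \<Rightarrow> 'a \<Rightarrow> real) \<Rightarrow> 'd \<Rightarrow> real \<Rightarrow> real \<Rightarrow> real" where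
  "mbar_an M V \<iota> h \<beta> =
     (if h = 0 then Lim (at_right 0) (\<lambda>h'. mbar_an_pos M V \<iota> h' \<beta>) else mbar_an_pos M V \<iota> h \<beta>)"

text \<open>
  \<open>b\<close> is the critical parameter for the drift \<open>h\<close>: the unique positive number with
  \<open>mbar_an M V \<iota> 0 b = h\<close>.  This is a relation and not a function because such a number need not
  exist for large \<open>h\<close> (for instance when the potential vanishes with positive probability), and
  a description operator would then return a meaningless value.
\<close>

definition is_beta_c_an ::
  "'a measure \<Rightarrow> (int ^ 'd::finite \<Rightarrow> 'a \<Rightarrow> real) \<Rightarrow> 'd \<Rightarrow> real \<Rightarrow> real \<Rightarrow> bool" where
  "is_beta_c_an M V \<iota> h b \<longleftrightarrow>
     b > 0 \<and> mbar_an M V \<iota> 0 b = h \<and> (\<forall>b'>0. mbar_an M V \<iota> 0 b' = h \<longrightarrow> b' = b)"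

end

theory Submission
  imports Defs
begin

text \<open>
  Since \<open>\<Sum>\<^sub>x \<ell>\<^sub>x(N)\<^sup>2\<close> counts the pairs \<open>i, j \<le> N\<close> with \<open>S(i) = S(j)\<close>, its annealed mean is bounded by
  cutting out the loop between \<open>i\<close> and \<open>j\<close>: this can only decrease \<open>\<Phi>\<close>, so a loop of length \<open>r\<close> costs at
  most \<open>P\<^sub>h[S(r) = 0] Z(N - r) \<le> q\<^sup>r Z(N) / Z(r)\<close>, where \<open>q = 2d / \<Sum>\<^sub>e exp (h e\<^sub>1) < 1\<close> and the last step is
  supermultiplicativity of \<open>Z\<close>. As \<open>Z(r) \<ge> exp (- m r) / K\<close>, the mean is at most a constant times \<open>N\<close> once
  \<open>q < exp (- m)\<close>, and Markov's inequality gives the claim; here \<open>\<epsilon> < 1 / K \<le> 1\<close>.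

  The inequality \<open>q < exp (- m)\<close> is where \<open>\<beta>\<^sub>0 < \<beta>\<^sub>c\<close> enters. Decomposing at the first hitting time of a
  hyperplane makes the sums defining \<open>mbar\<close> supermultiplicative up to a constant, so the limit exists;
  \<open>mbar(h', \<beta>) + h'\<close> is nonnegative and nondecreasing in \<open>h'\<close>, so \<open>mbar(0, \<beta>)\<close> is its infimum, and it is
  monotone in \<open>\<beta>\<close>. Uniqueness of \<open>\<beta>\<^sub>c\<close> then yields \<open>h' > 0\<close> with \<open>mbar(h', \<beta>\<^sub>0) + h' < h\<close>. Tilting from \<open>h'\<close> to
  \<open>h\<close> and summing over all hyperplanes shows that \<open>\<Sum>\<^sub>n (q' / q)\<^sup>n Z(n)\<close> diverges, with \<open>q' < 1\<close>
  the value of \<open>q\<close> for the drift \<open>h'\<close>; since \<open>Z(n) \<le> exp (- m n)\<close>, this forces \<open>exp (- m) \<ge> q / q' > q\<close>.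
\<close>

section \<open>Paths and their weights\<close>

definition paths :: "nat \<Rightarrow> (int ^ 'd::finite) list set" where
  "paths n = {xs. set xs \<subseteq> unit_vectors \<and> length xs = n}"

lemma finite_paths [simp, intro]: "finite (paths n)"
  unfolding paths_def by (rule finite_lists_length_eq[OF finite_unit_vectors])

lemma card_paths: "card (paths n :: (int ^ 'd::finite) list set) = card (unit_vectors :: (int ^ 'd) set) ^ n"
  unfolding paths_def by (rule card_lists_length_eq[OF finite_unit_vectors])

lemma paths_0 [simp]: "paths 0 = {[]}"
  by (auto simp: paths_def)

lemma length_paths: "xs \<in> paths n \<Longrightarrow> length xs = n"
  by (simp add: paths_def)

lemma sum_paths_add:
  "(\<Sum>xs\<in>paths (m + n). f xs) = (\<Sum>ys\<in>paths m. \<Sum>zs\<in>paths n. f (ys @ zs))"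
  unfolding sum.cartesian_product
  by (rule sum.reindex_bij_witness[where i = "\<lambda>(ys, zs). ys @ zs" and j = "\<lambda>xs. (take m xs, drop m xs)"])
     (auto simp: paths_def dest: in_set_takeD in_set_dropD)

text \<open>The normalising constant of the step law. At drift 0 it is the number of unit vectors,
  so \<open>step_norm \<iota> 0 / step_norm \<iota> h\<close> is the loop ratio q of the
  overview.\<close>

definition step_norm :: "'d::finite \<Rightarrow> real \<Rightarrow> real" where
  "step_norm \<iota> h = (\<Sum>e\<in>unit_vectors. exp (h * real_of_int (e $ \<iota>)))"

text \<open>For unit steps this is the probability of the path. The product of the step weights
  depends only on endpoint and length, which makes a change of drift explicit.\<close>

definition path_weight :: "'d::finite \<Rightarrow> real \<Rightarrow> (int ^ 'd) list \<Rightarrow> real" where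
  "path_weight \<iota> h xs = exp (h * real_of_int (sum_list xs $ \<iota>)) / step_norm \<iota> h ^ length xs"

lemma step_norm_pos: "step_norm \<iota> h > 0"
  unfolding step_norm_def by (intro sum_pos finite_unit_vectors unit_vectors_nonempty) simp

lemma path_weight_pos: "path_weight \<iota> h xs > 0"
  by (simp add: path_weight_def step_norm_pos)

lemma path_weight_nonneg [simp]: "path_weight \<iota> h xs \<ge> 0"
  using path_weight_pos less_imp_le by blast

lemma path_weight_Nil [simp]: "path_weight \<iota> h [] = 1"
  by (simp add: path_weight_def)

lemma path_weight_append: "path_weight \<iota> h (xs @ ys) = path_weight \<iota> h xs * path_weight \<iota> h ys"
  by (simp add: path_weight_def distrib_left exp_add power_add)

lemma path_weight_eq_prod:
  "set xs \<subseteq> unit_vectors \<Longrightarrow> path_weight \<iota> h xs = (\<Prod>i<length xs. step_weight \<iota> h (xs ! i))"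
proof (induction xs rule: rev_induct)
  case (snoc x xs)
  have "(\<Prod>i<length xs. step_weight \<iota> h ((xs @ [x]) ! i)) = path_weight \<iota> h xs"
    using snoc by (auto intro!: prod.cong simp: nth_append)
  moreover have "path_weight \<iota> h [x] = step_weight \<iota> h x"
    using snoc by (simp add: path_weight_def step_weight_def step_norm_def)
  ultimately show ?case by (simp add: path_weight_append)
qed simp

text \<open>\<open>path_sum \<iota> h n F\<close> is the expectation \<open>E\<^sub>h\<close> of \<open>F\<close> applied to the list of the first \<open>n\<close>
  increments, see \<open>integral_walk_law\<close>.\<close>

definition path_sum :: "'d::finite \<Rightarrow> real \<Rightarrow> nat \<Rightarrow> ((int ^ 'd) list \<Rightarrow> real) \<Rightarrow> real" where
  "path_sum \<iota> h n F = (\<Sum>xs\<in>paths n. path_weight \<iota> h xs * F xs)"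

lemma path_sum_cong: "(\<And>xs. xs \<in> paths n \<Longrightarrow> F xs = G xs) \<Longrightarrow> path_sum \<iota> h n F = path_sum \<iota> h n G"
  by (simp add: path_sum_def)

lemma path_sum_mono: "(\<And>xs. xs \<in> paths n \<Longrightarrow> F xs \<le> G xs) \<Longrightarrow> path_sum \<iota> h n F \<le> path_sum \<iota> h n G"
  unfolding path_sum_def by (intro sum_mono mult_left_mono) auto

lemma path_sum_nonneg: "(\<And>xs. xs \<in> paths n \<Longrightarrow> F xs \<ge> 0) \<Longrightarrow> path_sum \<iota> h n F \<ge> 0"
  unfolding path_sum_def by (intro sum_nonneg) auto

lemma path_sum_cmult: "path_sum \<iota> h n (\<lambda>xs. c * F xs) = c * path_sum \<iota> h n F"
  unfolding path_sum_def sum_distrib_left by (intro sum.cong) simp_all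

lemma path_sum_cmult_right: "path_sum \<iota> h n (\<lambda>xs. F xs * c) = path_sum \<iota> h n F * c"
  unfolding path_sum_def sum_distrib_right by (intro sum.cong) simp_all

lemma path_sum_sum: "path_sum \<iota> h n (\<lambda>xs. \<Sum>i\<in>A. F i xs) = (\<Sum>i\<in>A. path_sum \<iota> h n (F i))"
  unfolding path_sum_def sum_distrib_left by (rule sum.swap)

lemma path_sum_diff: "path_sum \<iota> h n (\<lambda>xs. F xs - G xs) = path_sum \<iota> h n F - path_sum \<iota> h n G"
  by (simp add: path_sum_def right_diff_distrib sum_subtractf)

lemma path_sum_append:
  "path_sum \<iota> h (m + n) F = path_sum \<iota> h m (\<lambda>ys. path_sum \<iota> h n (\<lambda>zs. F (ys @ zs)))"
  by (simp add: path_sum_def sum_paths_add path_weight_append sum_distrib_left mult_ac)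

text \<open>All paths ending in the hyperplane have the same weight, and there are at most
  \<open>step_norm \<iota> 0 ^ n\<close> of them.\<close>

lemma path_sum_return:
  fixes \<iota> :: "'d::finite"
  shows "path_sum \<iota> h n (\<lambda>xs. of_bool (sum_list xs $ \<iota> = L)) \<le>
     exp (h * of_int L) * (step_norm \<iota> 0 / step_norm \<iota> h) ^ n"
proof -
  have "path_sum \<iota> h n (\<lambda>xs. of_bool (sum_list xs $ \<iota> = L)) \<le>
     (\<Sum>xs\<in>(paths n :: (int ^ 'd) list set). exp (h * of_int L) / step_norm \<iota> h ^ n)"
    unfolding path_sum_def
    by (intro sum_mono) (auto simp: path_weight_def length_paths step_norm_pos intro!: divide_nonneg_pos)
  also have "\<dots> = exp (h * of_int L) * (step_norm \<iota> 0 / step_norm \<iota> h) ^ n"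
    by (simp add: card_paths power_divide step_norm_def)
  finally show ?thesis .
qed

text \<open>Averaging over \<open>e\<close> and \<open>- e\<close> turns the exponentials into
  hyperbolic cosines, whose monotonicity is then available.\<close>

lemma step_norm_eq_cosh: "step_norm \<iota> h = (\<Sum>e\<in>unit_vectors. cosh (h * real_of_int (e $ \<iota>)))"
proof -
  have "step_norm \<iota> h = (\<Sum>e\<in>unit_vectors. exp (- (h * real_of_int (e $ \<iota>))))"
    unfolding step_norm_def
    by (rule sum.reindex_bij_witness[where i = uminus and j = uminus])
       (auto simp: unit_vectors_def axis_def vec_eq_iff)
  then have "2 * step_norm \<iota> h =
      (\<Sum>e\<in>unit_vectors. exp (h * real_of_int (e $ \<iota>)) + exp (- (h * real_of_int (e $ \<iota>))))"
    unfolding sum.distrib by (simp add: step_norm_def)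
  also have "\<dots> = 2 * (\<Sum>e\<in>unit_vectors. cosh (h * real_of_int (e $ \<iota>)))"
    by (simp add: cosh_field_def sum_distrib_left add_divide_distrib)
  finally show ?thesis by simp
qed

text \<open>Every cosine term is nondecreasing in the drift, and the unit vector
  \<open>axis \<iota> 1\<close> gives a strict increase. Hence the loop ratio is below 1 for
  positive drift.\<close>

lemma step_norm_strict_mono:
  fixes \<iota> :: "'d::finite"
  assumes "0 \<le> h" "h < h'"
  shows "step_norm \<iota> h < step_norm \<iota> h'"
  unfolding step_norm_eq_cosh
proof (rule sum_strict_mono_ex1)
  show "finite (unit_vectors :: (int ^ 'd) set)" by (rule finite_unit_vectors)
  have *: "cosh (h * real_of_int k) = cosh (h * real_of_int \<bar>k\<bar>)" for h k
    using cosh_minus[of "h * real_of_int k"] by (cases "k \<ge> 0") simp_all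
  show "\<forall>e\<in>(unit_vectors :: (int ^ 'd) set). cosh (h * real_of_int (e $ \<iota>)) \<le> cosh (h' * real_of_int (e $ \<iota>))"
  proof
    fix e :: "int ^ 'd"
    have "cosh (h * real_of_int \<bar>e $ \<iota>\<bar>) \<le> cosh (h' * real_of_int \<bar>e $ \<iota>\<bar>)"
      using assms by (subst cosh_real_nonneg_le_iff) (auto intro!: mult_right_mono)
    then show "cosh (h * real_of_int (e $ \<iota>)) \<le> cosh (h' * real_of_int (e $ \<iota>))"
      using * by metis
  qed
  show "\<exists>e\<in>(unit_vectors :: (int ^ 'd) set). cosh (h * real_of_int (e $ \<iota>)) < cosh (h' * real_of_int (e $ \<iota>))"
    using assms
    by (intro bexI[of _ "axis \<iota> 1"]) (auto simp: unit_vectors_def cosh_real_nonneg_less_iff)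
qed

section \<open>Local times and the energy of a path\<close>

text \<open>After the first step \<open>a\<close> the path starts afresh at \<open>a\<close>, hence
  the shift to \<open>x - a\<close>. The position at time 0 is not counted, as in
  \<open>local_time\<close>.\<close>

primrec visits :: "(int ^ 'd::finite) list \<Rightarrow> int ^ 'd \<Rightarrow> nat" where
  "visits [] x = 0"
| "visits (a # xs) x = of_bool (a = x) + visits xs (x - a)"

lemma visits_append: "visits (xs @ ys) x = visits xs x + visits ys (x - sum_list xs)"
  by (induction xs arbitrary: x) (auto simp: algebra_simps)

lemma visits_eq_sum: "visits xs x = (\<Sum>i=1..length xs. of_bool (sum_list (take i xs) = x))"
  by (induction xs rule: rev_induct) (auto simp: visits_append intro!: sum.cong)

lemma finite_visits: "finite {x. visits xs x \<noteq> 0}"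
proof (rule finite_subset)
  show "{x. visits xs x \<noteq> 0} \<subseteq> (\<lambda>i. sum_list (take i xs)) ` {1..length xs}"
    by (auto simp: visits_eq_sum card_gt_0_iff)
qed simp

lemmas finite_visits_pos [simp] = finite_visits[unfolded neq0_conv]

text \<open>When \<open>\<phi> 0 = 0\<close> this is a sum over the whole lattice. The annealed
  potential gives \<open>Phi_an\<close>; squares give the quantity truncated in
  \<open>Z_qu\<close>.\<close>

definition energy :: "(nat \<Rightarrow> real) \<Rightarrow> (int ^ 'd::finite) list \<Rightarrow> real" where
  "energy \<phi> xs = (\<Sum>x | visits xs x \<noteq> 0. \<phi> (visits xs x))"

lemma energy_eq_sum:
  assumes "\<phi> 0 = 0" "finite A" "\<And>x. visits xs x \<noteq> 0 \<Longrightarrow> x \<in> A"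
  shows "energy \<phi> xs = (\<Sum>x\<in>A. \<phi> (visits xs x))"
  unfolding energy_def using assms by (intro sum.mono_neutral_left) auto

lemma energy_Nil [simp]: "energy \<phi> [] = 0"
  by (simp add: energy_def)

text \<open>The square of a local time counts ordered pairs of times spent at the site; summing over
  sites leaves the pairs of times with equal positions.\<close>

lemma energy_square:
  "energy (\<lambda>n. (real n)\<^sup>2) xs =
     (\<Sum>i=1..length xs. \<Sum>j=1..length xs. of_bool (sum_list (take i xs) = sum_list (take j xs)))"
proof -
  let ?S = "\<lambda>i. sum_list (take i xs)"
  let ?I = "{1..length xs}"
  have "energy (\<lambda>n. (real n)\<^sup>2) xs = (\<Sum>x\<in>?S ` ?I. (real (visits xs x))\<^sup>2)"
    by (intro energy_eq_sum) (auto simp: visits_eq_sum)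
  also have "\<dots> = (\<Sum>x\<in>?S ` ?I. \<Sum>i\<in>?I. \<Sum>j\<in>?I. of_bool (?S i = x) * of_bool (?S j = x))"
    by (simp only: visits_eq_sum power2_eq_square of_nat_sum of_nat_of_bool sum_product)
  also have "\<dots> = (\<Sum>i\<in>?I. \<Sum>x\<in>?S ` ?I. \<Sum>j\<in>?I. of_bool (?S i = x) * of_bool (?S j = x))"
    by (rule sum.swap)
  also have "\<dots> = (\<Sum>i\<in>?I. \<Sum>j\<in>?I. \<Sum>x\<in>?S ` ?I. of_bool (?S i = x) * of_bool (?S j = x))"
    by (intro sum.cong refl sum.swap)
  also have "\<dots> = (\<Sum>i\<in>?I. \<Sum>j\<in>?I. of_bool (?S i = ?S j))"
  proof (intro sum.cong refl)
    fix i j assume "i \<in> ?I" "j \<in> ?I"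
    have "(\<Sum>x\<in>?S ` ?I. of_bool (?S i = x) * of_bool (?S j = x)) =
        (\<Sum>x\<in>?S ` ?I. if ?S i = x then of_bool (?S j = x) else 0 :: real)"
      by (intro sum.cong) auto
    also have "\<dots> = of_bool (?S j = ?S i)"
      using \<open>i \<in> ?I\<close> by (subst sum.delta') auto
    finally show "(\<Sum>x\<in>?S ` ?I. of_bool (?S i = x) * of_bool (?S j = x)) = (of_bool (?S i = ?S j) :: real)"
      by (simp add: eq_commute[of "?S j" "?S i"])
  qed
  finally show ?thesis .
qed

text \<open>The properties of the annealed potential at fixed \<open>\<beta>\<close> on which the
  path estimates rest; \<open>subadditive_potential_phi_an\<close> supplies them.\<close>

locale subadditive_potential =
  fixes \<phi> :: "nat \<Rightarrow> real"
  assumes zero [simp]: "\<phi> 0 = 0"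
    and mono: "m \<le> n \<Longrightarrow> \<phi> m \<le> \<phi> n"
    and subadd: "\<phi> (m + n) \<le> \<phi> m + \<phi> n"
begin

lemma energy_mono:
  assumes "\<And>x. visits xs x \<le> visits ys x"
  shows "energy \<phi> xs \<le> energy \<phi> ys"
proof -
  let ?A = "{x. visits ys x \<noteq> 0}"
  have "energy \<phi> xs = (\<Sum>x\<in>?A. \<phi> (visits xs x))"
  proof (intro energy_eq_sum)
    show "x \<in> ?A" if "visits xs x \<noteq> 0" for x
      using that assms[of x] by simp
  qed auto
  also have "\<dots> \<le> energy \<phi> ys"
    unfolding energy_def using assms by (intro sum_mono mono) auto
  finally show ?thesis .
qed

text \<open>A loop has no net displacement, so cutting it out leaves the later positions in place
  and no site gains visits.\<close>

lemma energy_excise: "sum_list ys = 0 \<Longrightarrow> energy \<phi> (xs @ zs) \<le> energy \<phi> (xs @ ys @ zs)"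
  by (rule energy_mono) (simp add: visits_append)

lemma energy_prefix: "energy \<phi> xs \<le> energy \<phi> (xs @ ys)"
  by (rule energy_mono) (simp add: visits_append)

lemma energy_nonneg: "energy \<phi> xs \<ge> 0"
  using energy_prefix[of "[]" xs] by simp

text \<open>Subadditivity of \<open>\<phi>\<close> is applied site by site to the visits of the
  first piece and of the second piece translated by the endpoint of the first.\<close>

lemma energy_append: "energy \<phi> (xs @ ys) \<le> energy \<phi> xs + energy \<phi> ys"
proof -
  let ?s = "sum_list xs"
  let ?A = "{x. visits xs x \<noteq> 0} \<union> (\<lambda>x. x + ?s) ` {x. visits ys x \<noteq> 0}"
  have fin: "finite ?A" by simp
  have A: "visits ys (x - ?s) \<noteq> 0 \<Longrightarrow> x \<in> ?A" for x
    using image_eqI[of x "\<lambda>x. x + ?s" "x - ?s"] by simp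
  have "energy \<phi> (xs @ ys) = (\<Sum>x\<in>?A. \<phi> (visits xs x + visits ys (x - ?s)))"
    using energy_eq_sum[of \<phi> ?A "xs @ ys"] A fin by (auto simp: visits_append)
  also have "\<dots> \<le> (\<Sum>x\<in>?A. \<phi> (visits xs x)) + (\<Sum>x\<in>?A. \<phi> (visits ys (x - ?s)))"
    unfolding sum.distrib[symmetric] by (intro sum_mono subadd)
  also have "(\<Sum>x\<in>?A. \<phi> (visits xs x)) = energy \<phi> xs"
    using energy_eq_sum[of \<phi> ?A xs] fin by auto
  also have "(\<Sum>x\<in>?A. \<phi> (visits ys (x - ?s))) = (\<Sum>x\<in>(\<lambda>x. x - ?s) ` ?A. \<phi> (visits ys x))"
    by (subst sum.reindex) (auto simp: inj_on_def)
  also have "\<dots> = energy \<phi> ys"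
  proof (rule energy_eq_sum[symmetric])
    fix x assume "visits ys x \<noteq> 0"
    then have "x + ?s \<in> ?A" using A[of "x + ?s"] by simp
    then show "x \<in> (\<lambda>x. x - ?s) ` ?A"
      using image_eqI[of x "\<lambda>x. x - ?s" "x + ?s"] by simp
  qed (use fin in auto)
  finally show ?thesis by simp
qed

end

section \<open>The second moment of the local times\<close>

lemma replicate_paths: "replicate n (axis \<iota> 1) \<in> paths n"
  unfolding paths_def unit_vectors_def by auto blast

text \<open>To either side of \<open>i\<close> each distance occurs at most once, so each side is
  bounded by a full geometric series.\<close>

lemma sum_geometric_distance_le:
  fixes \<rho> :: real
  assumes "0 \<le> \<rho>" "\<rho> < 1"
  shows "(\<Sum>j=1..N. \<rho> ^ (if i \<le> j then j - i else i - j)) \<le> 2 / (1 - \<rho>)"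
proof -
  have geom: "(\<Sum>j\<in>A. \<rho> ^ g j) \<le> 1 / (1 - \<rho>)" if "finite A" "inj_on g A" for A :: "nat set" and g
  proof -
    have "(\<Sum>j\<in>A. \<rho> ^ g j) = (\<Sum>k\<in>g ` A. \<rho> ^ k)"
      using that by (simp add: sum.reindex)
    also have "\<dots> \<le> (\<Sum>k. \<rho> ^ k)"
      using assms that by (intro sum_le_suminf summable_geometric) auto
    also have "\<dots> = 1 / (1 - \<rho>)"
      using assms by (intro suminf_geometric) auto
    finally show ?thesis .
  qed
  let ?g = "\<lambda>j. \<rho> ^ (if i \<le> j then j - i else i - j)"
  have "(\<Sum>j=1..N. ?g j) = (\<Sum>j\<in>{1..N} \<inter> {i..}. ?g j) + (\<Sum>j\<in>{1..N} - {i..}. ?g j)"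
    by (rule sum.Int_Diff) simp
  also have "(\<Sum>j\<in>{1..N} \<inter> {i..}. ?g j) = (\<Sum>j\<in>{1..N} \<inter> {i..}. \<rho> ^ (j - i))"
    by (intro sum.cong) auto
  also have "(\<Sum>j\<in>{1..N} - {i..}. ?g j) = (\<Sum>j\<in>{1..N} - {i..}. \<rho> ^ (i - j))"
    by (intro sum.cong) auto
  also have "(\<Sum>j\<in>{1..N} \<inter> {i..}. \<rho> ^ (j - i)) + \<dots> \<le> 1 / (1 - \<rho>) + 1 / (1 - \<rho>)"
    by (intro add_mono geom) (auto simp: inj_on_def)
  finally show ?thesis by simp
qed

section \<open>Partition functions and the cost of loops\<close>

context subadditive_potential
begin

definition partition_fn :: "'d::finite \<Rightarrow> real \<Rightarrow> nat \<Rightarrow> real" where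
  "partition_fn \<iota> h n = path_sum \<iota> h n (\<lambda>xs. exp (- energy \<phi> xs))"

lemma partition_0 [simp]: "partition_fn \<iota> h 0 = 1"
  by (simp add: partition_fn_def path_sum_def)

lemma partition_pos: "partition_fn \<iota> h n > 0"
  unfolding partition_fn_def path_sum_def
  by (rule sum_pos) (use replicate_paths in \<open>auto simp: path_weight_pos\<close>)

text \<open>The two stretches of a path are independent, and joining them costs at most the sum of
  their energies.\<close>

lemma partition_mult_le: "partition_fn \<iota> h m * partition_fn \<iota> h n \<le> partition_fn \<iota> h (m + n)"
proof -
  have "partition_fn \<iota> h m * partition_fn \<iota> h n =
      path_sum \<iota> h m (\<lambda>ys. path_sum \<iota> h n (\<lambda>zs. exp (- energy \<phi> ys) * exp (- energy \<phi> zs)))"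
    by (simp add: partition_fn_def path_sum_cmult path_sum_cmult_right)
  also have "\<dots> \<le> partition_fn \<iota> h (m + n)"
    unfolding partition_fn_def path_sum_append
    by (intro path_sum_mono) (simp add: exp_add[symmetric], smt (verit) energy_append)
  finally show ?thesis .
qed

text \<open>By \<open>energy_excise\<close> the loop drops out of the energy, and its
  \<open>r\<close> steps separate from the rest. Of the loop only the return of coordinate
  \<open>\<iota>\<close> is kept, which \<open>path_sum_return\<close> bounds.\<close>

lemma path_sum_loop_le:
  "path_sum \<iota> h (m + (r + n)) (\<lambda>xs. of_bool (sum_list (take r (drop m xs)) = 0) * exp (- energy \<phi> xs)) \<le>
     partition_fn \<iota> h (m + n) * (step_norm \<iota> 0 / step_norm \<iota> h) ^ r"
proof -
  have "path_sum \<iota> h (m + (r + n)) (\<lambda>xs. of_bool (sum_list (take r (drop m xs)) = 0) * exp (- energy \<phi> xs)) \<le>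
      path_sum \<iota> h m (\<lambda>xs. path_sum \<iota> h r (\<lambda>ys. path_sum \<iota> h n (\<lambda>zs.
        of_bool (sum_list ys $ \<iota> = 0) * exp (- energy \<phi> (xs @ zs)))))"
    unfolding path_sum_append
    by (intro path_sum_mono) (auto simp: length_paths energy_excise)
  also have "\<dots> = path_sum \<iota> h m (\<lambda>xs. path_sum \<iota> h n (\<lambda>zs. exp (- energy \<phi> (xs @ zs)))) *
      path_sum \<iota> h r (\<lambda>ys. of_bool (sum_list ys $ \<iota> = 0))"
    by (simp add: path_sum_cmult path_sum_cmult_right)
  also have "\<dots> \<le> partition_fn \<iota> h (m + n) * (step_norm \<iota> 0 / step_norm \<iota> h) ^ r"
    unfolding partition_fn_def path_sum_append
    using path_sum_return[of \<iota> h r 0] by (intro mult_left_mono path_sum_nonneg) auto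
  finally show ?thesis .
qed

text \<open>Equal positions at times \<open>i\<close> and \<open>j\<close> mean that the steps in
  between form a loop. Supermultiplicativity restores the length \<open>N\<close>, with the
  partition function of the loop length in the denominator.\<close>

lemma path_sum_coincidence_le:
  fixes \<iota> :: "'d::finite"
  assumes "i \<le> j" "j \<le> N"
  shows "path_sum \<iota> h N (\<lambda>xs. of_bool (sum_list (take i xs) = sum_list (take j xs)) * exp (- energy \<phi> xs)) \<le>
     partition_fn \<iota> h N * ((step_norm \<iota> 0 / step_norm \<iota> h) ^ (j - i) / partition_fn \<iota> h (j - i))"
proof -
  let ?r = "j - i"
  have "sum_list (take i xs) = sum_list (take j xs) \<longleftrightarrow> sum_list (take ?r (drop i xs)) = 0" for xs :: "(int ^ 'd) list"
  proof -
    have "take j xs = take i xs @ take ?r (drop i xs)"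
      using assms take_add[of i ?r xs] by simp
    then show ?thesis by simp
  qed
  moreover have "N = i + (?r + (N - j))" using assms by simp
  ultimately have "path_sum \<iota> h N (\<lambda>xs. of_bool (sum_list (take i xs) = sum_list (take j xs)) * exp (- energy \<phi> xs)) \<le>
      partition_fn \<iota> h (i + (N - j)) * (step_norm \<iota> 0 / step_norm \<iota> h) ^ ?r"
    using path_sum_loop_le[of \<iota> h i ?r "N - j"] by simp
  also have "\<dots> \<le> partition_fn \<iota> h N / partition_fn \<iota> h ?r * (step_norm \<iota> 0 / step_norm \<iota> h) ^ ?r"
  proof (intro mult_right_mono)
    have "partition_fn \<iota> h (i + (N - j)) * partition_fn \<iota> h ?r \<le> partition_fn \<iota> h N"
      using partition_mult_le[of \<iota> h "i + (N - j)" ?r] assms by (simp add: algebra_simps)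
    then show "partition_fn \<iota> h (i + (N - j)) \<le> partition_fn \<iota> h N / partition_fn \<iota> h ?r"
      by (simp add: pos_le_divide_eq partition_pos)
  qed (simp add: step_norm_pos less_imp_le)
  finally show ?thesis by simp
qed

text \<open>By the lower bound on the partition function, a pair of times at distance
  \<open>r\<close> contributes at most \<open>\<rho> ^ r / c\<close> relative to
  \<open>partition_fn \<iota> h N\<close>. As \<rho> < 1, the sum over one time is bounded uniformly
  in the other.\<close>

lemma path_sum_energy_square_le:
  fixes \<iota> :: "'d::finite"
  assumes "s > 0" "c > 0" and s: "step_norm \<iota> 0 / step_norm \<iota> h < s"
    and lower: "\<And>r. partition_fn \<iota> h r \<ge> c * s ^ r"
  defines "\<rho> \<equiv> step_norm \<iota> 0 / step_norm \<iota> h / s"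
  shows "path_sum \<iota> h N (\<lambda>xs. energy (\<lambda>n. (real n)\<^sup>2) xs * exp (- energy \<phi> xs)) \<le>
    2 / (c * (1 - \<rho>)) * real N * partition_fn \<iota> h N"
proof -
  let ?q = "step_norm \<iota> 0 / step_norm \<iota> h"
  let ?d = "\<lambda>i j::nat. if i \<le> j then j - i else i - j"
  let ?B = "\<lambda>i j (xs :: (int ^ 'd) list). of_bool (sum_list (take i xs) = sum_list (take j xs)) :: real"
  have \<rho>: "0 \<le> \<rho>" "\<rho> < 1"
    using \<open>s > 0\<close> s by (simp_all add: \<rho>_def step_norm_pos less_imp_le pos_divide_less_eq mult.commute)
  have q: "?q ^ r / partition_fn \<iota> h r \<le> \<rho> ^ r / c" for r
  proof -
    have "?q ^ r / partition_fn \<iota> h r \<le> ?q ^ r / (c * s ^ r)"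
      using assms by (intro divide_left_mono mult_pos_pos lower partition_pos) (auto simp: step_norm_pos less_imp_le)
    also have "\<dots> = \<rho> ^ r / c" by (simp add: \<rho>_def power_divide power_mult_distrib)
    finally show ?thesis .
  qed
  have le: "path_sum \<iota> h N (\<lambda>xs. ?B i j xs * exp (- energy \<phi> xs)) \<le> partition_fn \<iota> h N * (\<rho> ^ ?d i j / c)"
    if "i \<le> N" "j \<le> N" for i j
  proof -
    have sym: "path_sum \<iota> h N (\<lambda>xs. ?B i j xs * exp (- energy \<phi> xs)) =
        path_sum \<iota> h N (\<lambda>xs. ?B j i xs * exp (- energy \<phi> xs))"
      by (intro path_sum_cong) (simp add: eq_commute)
    have "path_sum \<iota> h N (\<lambda>xs. ?B i j xs * exp (- energy \<phi> xs)) \<le>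
        partition_fn \<iota> h N * (?q ^ ?d i j / partition_fn \<iota> h (?d i j))"
    proof (cases "i \<le> j")
      case True
      then show ?thesis using path_sum_coincidence_le[of i j N \<iota> h] that by simp
    next
      case False
      then show ?thesis
        unfolding sym using path_sum_coincidence_le[of j i N \<iota> h] that by simp
    qed
    also have "\<dots> \<le> partition_fn \<iota> h N * (\<rho> ^ ?d i j / c)"
      by (intro mult_left_mono q less_imp_le partition_pos)
    finally show ?thesis .
  qed
  have "path_sum \<iota> h N (\<lambda>xs. energy (\<lambda>n. (real n)\<^sup>2) xs * exp (- energy \<phi> xs)) =
      path_sum \<iota> h N (\<lambda>xs. \<Sum>i=1..N. \<Sum>j=1..N. ?B i j xs * exp (- energy \<phi> xs))"
    by (intro path_sum_cong) (simp add: energy_square length_paths sum_distrib_right)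
  also have "\<dots> = (\<Sum>i=1..N. \<Sum>j=1..N. path_sum \<iota> h N (\<lambda>xs. ?B i j xs * exp (- energy \<phi> xs)))"
    by (simp only: path_sum_sum)
  also have "\<dots> \<le> (\<Sum>i=1..N. \<Sum>j=1..N. partition_fn \<iota> h N * (\<rho> ^ ?d i j / c))"
    by (intro sum_mono le) auto
  also have "\<dots> = (\<Sum>i=1..N. partition_fn \<iota> h N / c * (\<Sum>j=1..N. \<rho> ^ ?d i j))"
    by (simp only: sum_distrib_left times_divide_eq_right times_divide_eq_left)
  also have "\<dots> \<le> (\<Sum>i=1..N. partition_fn \<iota> h N / c * (2 / (1 - \<rho>)))"
    using assms by (intro sum_mono mult_left_mono sum_geometric_distance_le \<rho>)
      (simp add: partition_pos less_imp_le)
  finally show ?thesis by (simp add: mult_ac)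
qed

text \<open>Markov's inequality for the sum of squared local times under the weights
  \<open>exp (- energy \<phi> xs)\<close>. The value of \<open>k\<close> makes the share of paths
  above the threshold at most \<open>1 - \<epsilon>\<close>.\<close>

lemma path_sum_energy_square_bounded_ge:
  fixes \<iota> :: "'d::finite"
  assumes "s > 0" "c > 0" and s: "step_norm \<iota> 0 / step_norm \<iota> h < s"
    and lower: "\<And>r. partition_fn \<iota> h r \<ge> c * s ^ r"
    and "\<epsilon> < 1" "N \<ge> 1"
  defines "k \<equiv> 2 / (c * (1 - step_norm \<iota> 0 / step_norm \<iota> h / s)) / (1 - \<epsilon>)"
  shows "path_sum \<iota> h N (\<lambda>xs. of_bool (energy (\<lambda>n. (real n)\<^sup>2) xs \<le> k * real N) * exp (- energy \<phi> xs)) \<ge>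
    \<epsilon> * partition_fn \<iota> h N"
proof -
  let ?Q = "energy (\<lambda>n. (real n)\<^sup>2) :: (int ^ 'd) list \<Rightarrow> real"
  let ?e = "\<lambda>xs :: (int ^ 'd) list. exp (- energy \<phi> xs)"
  have "step_norm \<iota> 0 / step_norm \<iota> h / s < 1"
    using \<open>s > 0\<close> s by (simp only: pos_divide_less_eq mult_1)
  then have k: "k * real N > 0"
    using \<open>c > 0\<close> \<open>\<epsilon> < 1\<close> \<open>N \<ge> 1\<close> unfolding k_def
    by (intro divide_pos_pos mult_pos_pos) simp_all
  have "partition_fn \<iota> h N - path_sum \<iota> h N (\<lambda>xs. of_bool (?Q xs \<le> k * real N) * ?e xs) =
     path_sum \<iota> h N (\<lambda>xs. ?e xs - of_bool (?Q xs \<le> k * real N) * ?e xs)"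
    by (simp add: partition_fn_def path_sum_diff)
  also have "\<dots> \<le> path_sum \<iota> h N (\<lambda>xs. 1 / (k * real N) * (?Q xs * ?e xs))"
  proof (rule path_sum_mono)
    fix xs :: "(int ^ 'd) list"
    have "of_bool (\<not> ?Q xs \<le> k * real N) \<le> ?Q xs / (k * real N)"
      using k by (auto simp: energy_def intro!: divide_nonneg_pos sum_nonneg)
    from mult_right_mono[OF this, of "?e xs"]
    show "?e xs - of_bool (?Q xs \<le> k * real N) * ?e xs \<le> 1 / (k * real N) * (?Q xs * ?e xs)"
      by (auto split: if_splits)
  qed
  also have "\<dots> \<le> 1 / (k * real N) * (k * (1 - \<epsilon>) * real N * partition_fn \<iota> h N)"
    unfolding path_sum_cmult
  proof (intro mult_left_mono)
    have "k * (1 - \<epsilon>) = 2 / (c * (1 - step_norm \<iota> 0 / step_norm \<iota> h / s))"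
      unfolding k_def using \<open>\<epsilon> < 1\<close> by (subst times_divide_eq_left, subst nonzero_mult_div_cancel_right) auto
    then show "path_sum \<iota> h N (\<lambda>xs. ?Q xs * ?e xs) \<le> k * (1 - \<epsilon>) * real N * partition_fn \<iota> h N"
      using path_sum_energy_square_le[OF assms(1-4), of N] by simp
  qed (use k in simp)
  also have "\<dots> = (1 - \<epsilon>) * partition_fn \<iota> h N"
    using k by (cases "k = 0") auto
  finally show ?thesis by (simp add: algebra_simps)
qed

end

section \<open>Path sums as expectations\<close>

text \<open>Almost surely the first \<open>n\<close> increments are unit vectors, so the integrand
  is a finite combination of indicators of cylinders, each of probability
  \<open>path_weight\<close>.\<close>

lemma integral_walk_law:
  fixes F :: "(int ^ 'd::finite) list \<Rightarrow> real"
  shows "(LINT \<xi>|walk_law \<iota> h. F (map \<xi> [0..<n])) = path_sum \<iota> h n F"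
proof -
  let ?M = "\<lambda>_::nat. measure_pmf (step_pmf \<iota> h)"
  interpret P: product_prob_space ?M UNIV
    by (intro product_prob_spaceI measure_pmf.prob_space_axioms)
  let ?P = "Pi\<^sub>M UNIV ?M"
  define E where "E xs = {\<xi> :: nat \<Rightarrow> int ^ 'd. map \<xi> [0..<n] = xs}" for xs
  have emb: "E xs = prod_emb UNIV ?M {..<n} (\<Pi>\<^sub>E i\<in>{..<n}. {xs ! i})" if "length xs = n" for xs
    using that by (auto simp: E_def prod_emb_def list_eq_iff_nth_eq PiE_def Pi_def restrict_def extensional_def)
  have E_sets: "E xs \<in> sets ?P" for xs
  proof (cases "length xs = n")
    case True
    then show ?thesis by (auto simp: emb intro!: sets_PiM_I)
  next
    case False
    then have "E xs = {}" by (auto simp: E_def)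
    then show ?thesis by simp
  qed
  have meas: "(\<lambda>\<xi>. map \<xi> [0..<n]) \<in> measurable ?P (count_space UNIV)"
    using E_sets by (auto simp: measurable_count_space_eq2_countable space_PiM E_def vimage_def)
  have [measurable]: "(\<lambda>\<xi>. F (map \<xi> [0..<n])) \<in> borel_measurable ?P"
    by (rule measurable_compose[OF meas]) simp
  have measure_E: "measure ?P (E xs) = path_weight \<iota> h xs" if "xs \<in> paths n" for xs
  proof -
    have "measure ?P (E xs) = (\<Prod>i<n. measure (measure_pmf (step_pmf \<iota> h)) {xs ! i})"
      using that by (subst emb) (auto simp: length_paths intro!: P.measure_PiM_emb)
    also have "\<dots> = path_weight \<iota> h xs"
      using that by (subst path_weight_eq_prod) (auto simp: paths_def measure_pmf_single pmf_step_pmf)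
    finally show ?thesis .
  qed
  have step: "AE \<xi> in ?P. \<xi> i \<in> unit_vectors" for i
  proof -
    have "AE e in measure_pmf (step_pmf \<iota> h). e \<in> unit_vectors"
      by (auto simp: AE_measure_pmf_iff set_pmf_iff pmf_step_pmf step_weight_def split: if_splits)
    then have "AE e in distr ?P (measure_pmf (step_pmf \<iota> h)) (\<lambda>\<xi>. \<xi> i). e \<in> unit_vectors"
      by (subst P.PiM_component) auto
    then show ?thesis
      by (rule AE_distrD[rotated]) simp
  qed
  have "AE \<xi> in ?P. \<forall>i\<in>{..<n}. \<xi> i \<in> unit_vectors"
    by (rule AE_finite_allI) (use step in auto)
  then have "AE \<xi> in ?P. F (map \<xi> [0..<n]) = (\<Sum>xs\<in>paths n. F xs * indicator (E xs) \<xi>)"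
  proof eventually_elim
    fix \<xi> :: "nat \<Rightarrow> int ^ 'd"
    assume "\<forall>i\<in>{..<n}. \<xi> i \<in> unit_vectors"
    then have "map \<xi> [0..<n] \<in> paths n" by (auto simp: paths_def)
    then have "F (map \<xi> [0..<n]) = (\<Sum>xs\<in>paths n. if map \<xi> [0..<n] = xs then F xs else 0)"
      by simp
    also have "\<dots> = (\<Sum>xs\<in>paths n. F xs * indicator (E xs) \<xi>)"
      by (intro sum.cong) (auto simp: E_def)
    finally show "F (map \<xi> [0..<n]) = (\<Sum>xs\<in>paths n. F xs * indicator (E xs) \<xi>)" .
  qed
  then have "(LINT \<xi>|?P. F (map \<xi> [0..<n])) = (LINT \<xi>|?P. (\<Sum>xs\<in>paths n. F xs * indicator (E xs) \<xi>))"
    by (intro integral_cong_AE borel_measurable_sum borel_measurable_times borel_measurable_const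
      borel_measurable_indicator E_sets) measurable
  also have "\<dots> = (\<Sum>xs\<in>paths n. F xs * measure ?P (E xs))"
  proof -
    have "integrable ?P (indicator (E xs) :: _ \<Rightarrow> real)" for xs
      using E_sets by (intro integrable_real_indicator) (auto simp: P.emeasure_eq_measure)
    then show ?thesis by (subst Bochner_Integration.integral_sum) (auto simp: space_PiM)
  qed
  also have "\<dots> = path_sum \<iota> h n F"
    unfolding path_sum_def by (intro sum.cong) (auto simp: measure_E)
  finally show ?thesis unfolding walk_law_def .
qed

lemma prob_space_walk_law: "prob_space (walk_law \<iota> h)"
  unfolding walk_law_def by (intro prob_space_PiM measure_pmf.prob_space_axioms)

lemma path_sum_one: "path_sum \<iota> h n (\<lambda>_. 1) = 1"
  using integral_walk_law[of \<iota> h "\<lambda>_. 1" n] prob_space.prob_space[OF prob_space_walk_law, of \<iota> h]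
  by simp

lemma walk_eq_sum_list: "walk \<xi> n = sum_list (map \<xi> [0..<n])"
  unfolding walk_def by (simp add: interv_sum_list_conv_sum_set_nat atLeast0LessThan)

lemma local_time_eq_visits: "local_time \<xi> N x = visits (map \<xi> [0..<N]) x"
proof -
  have "local_time \<xi> N x = (\<Sum>i=1..N. of_bool (walk \<xi> i = x))"
    by (simp add: local_time_def Int_def)
  also have "\<dots> = visits (map \<xi> [0..<N]) x"
    unfolding visits_eq_sum by (auto simp: walk_eq_sum_list take_map intro!: sum.cong)
  finally show ?thesis .
qed

lemma infsum_UNIV_eq_sum:
  assumes "finite A" "\<And>x. x \<notin> A \<Longrightarrow> f x = 0"
  shows "(\<Sum>\<^sub>\<infinity>x. f x) = sum f A"
proof -
  have "(\<Sum>\<^sub>\<infinity>x. f x) = (\<Sum>\<^sub>\<infinity>x\<in>A. f x)"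
    using assms(2) by (intro infsum_cong_neutral) auto
  then show ?thesis using assms(1) by simp
qed

lemma infsum_local_time_eq_energy:
  assumes "\<phi> 0 = 0"
  shows "(\<Sum>\<^sub>\<infinity>x. \<phi> (local_time \<xi> N x)) = energy \<phi> (map \<xi> [0..<N])"
  unfolding local_time_eq_visits energy_def
  by (rule infsum_UNIV_eq_sum) (use assms in auto)

section \<open>The annealed potential\<close>

text \<open>Each number \<open>- 1 / real (Suc n)\<close> lies strictly below the essential infimum
  and so is an almost sure lower bound; countably many such bounds hold together.\<close>

lemma AE_nonneg_of_ess_inf:
  assumes "ess_inf M f = 0"
  shows "AE \<omega> in M. 0 \<le> f \<omega>"
proof -
  have "AE \<omega> in M. - 1 / real (Suc n) \<le> f \<omega>" for n
  proof -
    have "ereal (- 1 / real (Suc n)) < ess_inf M f"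
      by (simp add: assms zero_ereal_def)
    then obtain z where z: "ereal (- 1 / real (Suc n)) < z" "AE \<omega> in M. z \<le> ereal (f \<omega>)"
      unfolding ess_inf_def by (auto simp: less_Sup_iff)
    from z(2) show ?thesis
    proof eventually_elim
      fix \<omega> assume "z \<le> ereal (f \<omega>)"
      with z(1) have "ereal (- 1 / real (Suc n)) < ereal (f \<omega>)" by (rule less_le_trans)
      then show "- 1 / real (Suc n) \<le> f \<omega>" by simp
    qed
  qed
  then have "AE \<omega> in M. \<forall>n. - 1 / real (Suc n) \<le> f \<omega>"
    by (simp add: AE_all_countable)
  then show ?thesis
  proof eventually_elim
    fix \<omega> assume *: "\<forall>n. - 1 / real (Suc n) \<le> f \<omega>"
    show "0 \<le> f \<omega>"
    proof (rule ccontr)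
      assume "\<not> 0 \<le> f \<omega>"
      then obtain n where "inverse (real (Suc n)) < - f \<omega>"
        using reals_Archimedean[of "- f \<omega>"] by auto
      then show False using *[rule_format, of n] by (simp add: field_simps)
    qed
  qed
qed

locale iid_nonneg_potential = prob_space M
  for M :: "'a measure" +
  fixes V :: "int ^ 'd::finite \<Rightarrow> 'a \<Rightarrow> real"
  assumes indep: "indep_vars (\<lambda>_. borel) V UNIV"
    and distr_eq: "\<And>x. distr M borel (V x) = distr M borel (V 0)"
    and V_nonneg: "\<And>x. AE \<omega> in M. 0 \<le> V x \<omega>"
begin

lemma V_measurable [measurable]: "V x \<in> borel_measurable M"
  using indep by (auto simp: indep_vars_def)

lemma integrable_exp_V:
  assumes "t \<ge> 0"
  shows "integrable M (\<lambda>\<omega>. exp (- (t * V x \<omega>)))"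
proof (rule integrable_const_bound[where B = 1])
  show "AE \<omega> in M. norm (exp (- (t * V x \<omega>))) \<le> 1"
    using V_nonneg[of x] by eventually_elim (use assms in simp)
qed simp

lemma integral_exp_V_eq: "(LINT \<omega>|M. exp (- (t * V x \<omega>))) = (LINT \<omega>|M. exp (- (t * V 0 \<omega>)))"
proof -
  have "(LINT \<omega>|M. exp (- (t * V x \<omega>))) = (LINT v|distr M borel (V x). exp (- (t * v)))" for x
    by (rule integral_distr[symmetric]) auto
  then show ?thesis by (simp only: distr_eq[of x])
qed

definition laplace :: "real \<Rightarrow> real" where
  "laplace t = (LINT \<omega>|M. exp (- (t * V 0 \<omega>)))"

lemma laplace_0 [simp]: "laplace 0 = 1"
  by (simp add: laplace_def prob_space)

lemma laplace_pos: "t \<ge> 0 \<Longrightarrow> laplace t > 0"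
  unfolding laplace_def by (intro expectation_greater integrable_exp_V) auto

lemma laplace_antimono:
  assumes "0 \<le> s" "s \<le> t"
  shows "laplace t \<le> laplace s"
  unfolding laplace_def
proof (rule integral_mono_AE)
  show "AE \<omega> in M. exp (- (t * V 0 \<omega>)) \<le> exp (- (s * V 0 \<omega>))"
    using V_nonneg[of 0] by eventually_elim (use assms in \<open>auto intro: mult_right_mono\<close>)
qed (use assms in \<open>auto intro: integrable_exp_V\<close>)

text \<open>Two decreasing functions of one random variable are positively correlated. This makes
  \<open>phi_an\<close> subadditive.\<close>

lemma laplace_add_ge:
  assumes "s \<ge> 0" "t \<ge> 0"
  shows "laplace s * laplace t \<le> laplace (s + t)"
proof (cases "s = 0")
  case False
  \<comment> \<open>Both exponentials decrease in \<open>V\<close> and cross the levels \<open>laplace s\<close> and \<open>exp (- t c)\<close> at \<open>V = c\<close>.\<close>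
  define c where "c = - ln (laplace s) / s"
  let ?f = "\<lambda>\<omega>. exp (- (s * V 0 \<omega>))" and ?g = "\<lambda>\<omega>. exp (- (t * V 0 \<omega>))"
  let ?a = "laplace s" and ?b = "exp (- (t * c))"
  have a: "?a = exp (- (s * c))"
    using False laplace_pos[OF assms(1)] by (simp add: c_def)
  have "(?f \<omega> - ?a) * (?g \<omega> - ?b) \<ge> 0" for \<omega>
  proof (cases "V 0 \<omega> \<le> c")
    case True
    then show ?thesis unfolding a using assms
      by (intro mult_nonneg_nonneg) (auto intro: mult_left_mono)
  next
    case False
    then show ?thesis unfolding a using assms
      by (intro mult_nonpos_nonpos) (auto intro: mult_left_mono)
  qed
  then have "0 \<le> (LINT \<omega>|M. (?f \<omega> - ?a) * (?g \<omega> - ?b))"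
    by (intro integral_nonneg_AE) auto
  also have "\<dots> = (LINT \<omega>|M. exp (- ((s + t) * V 0 \<omega>)) - ?a * ?g \<omega> - ?b * (?f \<omega> - ?a))"
    by (intro Bochner_Integration.integral_cong) (auto simp: algebra_simps exp_add[symmetric])
  also have "\<dots> = laplace (s + t) - ?a * laplace t - ?b * (laplace s - ?a)"
    using assms by (simp add: integrable_exp_V laplace_def prob_space)
  finally show ?thesis by simp
qed simp

lemma phi_an_eq: "phi_an M V \<beta> t = - ln (laplace (t * \<beta>))"
  by (simp add: phi_an_def laplace_def)

lemma subadditive_potential_phi_an:
  assumes "\<beta> \<ge> 0"
  shows "subadditive_potential (\<lambda>n. phi_an M V \<beta> (real n))"
proof
  fix m n :: nat
  show "phi_an M V \<beta> (real m) \<le> phi_an M V \<beta> (real n)" if "m \<le> n"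
    using assms that by (auto simp: phi_an_eq laplace_pos intro!: laplace_antimono mult_right_mono)
  have "ln (laplace (real m * \<beta>) * laplace (real n * \<beta>)) \<le> ln (laplace (real m * \<beta> + real n * \<beta>))"
    using assms by (subst ln_le_cancel_iff) (auto intro!: laplace_add_ge mult_pos_pos laplace_pos)
  then show "phi_an M V \<beta> (real (m + n)) \<le> phi_an M V \<beta> (real m) + phi_an M V \<beta> (real n)"
    using assms laplace_pos[of "real m * \<beta>"] laplace_pos[of "real n * \<beta>"]
    by (simp add: phi_an_eq ln_mult distrib_right)
qed (simp add: phi_an_eq)

lemma phi_an_mono: "0 \<le> \<beta> \<Longrightarrow> \<beta> \<le> \<beta>' \<Longrightarrow> phi_an M V \<beta> (real n) \<le> phi_an M V \<beta>' (real n)"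
  by (auto simp: phi_an_eq laplace_pos intro!: laplace_antimono mult_left_mono)

text \<open>Independence factorises the expectation over the sites, and by identical distribution
  each factor is a value of the Laplace transform of \<open>V 0\<close>.\<close>

lemma integral_exp_sum_V:
  assumes "finite A" "\<beta> \<ge> 0"
  shows "integrable M (\<lambda>\<omega>. exp (- \<beta> * (\<Sum>x\<in>A. real (l x) * V x \<omega>)))"
    and "(LINT \<omega>|M. exp (- \<beta> * (\<Sum>x\<in>A. real (l x) * V x \<omega>))) =
      exp (- (\<Sum>x\<in>A. phi_an M V \<beta> (real (l x))))"
proof -
  let ?X = "\<lambda>x \<omega>. exp (- (real (l x) * \<beta> * V x \<omega>))"
  have *: "exp (- \<beta> * (\<Sum>x\<in>A. real (l x) * V x \<omega>)) = (\<Prod>x\<in>A. ?X x \<omega>)" for \<omega>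
    using assms by (simp add: exp_sum[symmetric] sum_distrib_left sum_negf mult_ac)
  have ind: "indep_vars (\<lambda>_. borel) ?X A"
    using indep_vars_compose2[OF indep_vars_subset[OF indep, of A], of "\<lambda>x v. exp (- (real (l x) * \<beta> * v))"]
    by auto
  have int: "\<And>x. x \<in> A \<Longrightarrow> integrable M (?X x)"
    using assms by (intro integrable_exp_V) auto
  show "integrable M (\<lambda>\<omega>. exp (- \<beta> * (\<Sum>x\<in>A. real (l x) * V x \<omega>)))"
    unfolding * by (rule indep_vars_integrable[OF assms(1) ind int])
  have "(LINT \<omega>|M. exp (- \<beta> * (\<Sum>x\<in>A. real (l x) * V x \<omega>))) = (\<Prod>x\<in>A. LINT \<omega>|M. ?X x \<omega>)"
    unfolding * by (rule indep_vars_lebesgue_integral[OF assms(1) ind int])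
  also have "\<dots> = (\<Prod>x\<in>A. laplace (real (l x) * \<beta>))"
    unfolding laplace_def using integral_exp_V_eq by (intro prod.cong) auto
  also have "\<dots> = (\<Prod>x\<in>A. exp (- phi_an M V \<beta> (real (l x))))"
    using assms by (intro prod.cong) (auto simp: phi_an_eq laplace_pos)
  finally show "(LINT \<omega>|M. exp (- \<beta> * (\<Sum>x\<in>A. real (l x) * V x \<omega>))) =
      exp (- (\<Sum>x\<in>A. phi_an M V \<beta> (real (l x))))"
    using assms by (simp add: exp_sum[symmetric] sum_negf)
qed

lemma Phi_an_eq_energy:
  "Phi_an M V \<beta> N \<xi> = energy (\<lambda>n. phi_an M V \<beta> (real n)) (map \<xi> [0..<N])"
  unfolding Phi_an_def
  by (rule infsum_local_time_eq_energy[where \<phi> = "\<lambda>n. phi_an M V \<beta> (real n)"]) (simp add: phi_an_eq)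

lemma Z_qu_eq_path_sum:
  "Z_qu \<iota> v h \<beta> k N = path_sum \<iota> h N (\<lambda>xs. of_bool (energy (\<lambda>n. (real n)\<^sup>2) xs \<le> k * real N) *
     exp (- \<beta> * (\<Sum>x | visits xs x \<noteq> 0. real (visits xs x) * v x)))"
proof -
  have "(\<Sum>\<^sub>\<infinity>x. real (local_time \<xi> N x) * v x) =
      (\<Sum>x | visits (map \<xi> [0..<N]) x \<noteq> 0. real (visits (map \<xi> [0..<N]) x) * v x)" for \<xi>
    unfolding local_time_eq_visits by (rule infsum_UNIV_eq_sum) auto
  then show ?thesis
    unfolding Z_qu_def set_lebesgue_integral_def integral_walk_law[symmetric]
    by (intro Bochner_Integration.integral_cong)
       (auto simp: infsum_local_time_eq_energy[where \<phi> = "\<lambda>n. (real n)\<^sup>2"] indicator_def)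
qed

text \<open>The walk expectation is a finite sum, so it commutes with that over the potential. The
  truncation involves only the path, while the exponential averages to the annealed weight.\<close>

lemma integral_Z_qu:
  assumes "\<beta> \<ge> 0"
  shows "(LINT \<omega>|M. Z_qu \<iota> (\<lambda>x. V x \<omega>) h \<beta> k N) =
    path_sum \<iota> h N (\<lambda>xs. of_bool (energy (\<lambda>n. (real n)\<^sup>2) xs \<le> k * real N) *
      exp (- energy (\<lambda>n. phi_an M V \<beta> (real n)) xs))"
proof -
  note I = integral_exp_sum_V[OF finite_visits assms]
  show ?thesis
    unfolding Z_qu_eq_path_sum path_sum_def energy_def[of "\<lambda>n. phi_an M V \<beta> (real n)"]
    by (subst Bochner_Integration.integral_sum) (simp_all only: I integral_mult_right_zero
      integrable_mult_right_iff integrable_mult_right simp_thms)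
qed

lemma Z_an_eq: "Z_an M V \<iota> h \<beta> N = path_sum \<iota> h N (\<lambda>xs. exp (- energy (\<lambda>n. phi_an M V \<beta> (real n)) xs))"
  unfolding Z_an_def Phi_an_eq_energy by (rule integral_walk_law)

lemma integral_plane:
  "(LINT \<xi>:{\<xi>. walk \<xi> n $ \<iota> = L}|walk_law \<iota> h. exp (- Phi_an M V \<beta> n \<xi>)) =
    path_sum \<iota> h n (\<lambda>xs. of_bool (sum_list xs $ \<iota> = L) * exp (- energy (\<lambda>n. phi_an M V \<beta> (real n)) xs))"
  unfolding set_lebesgue_integral_def integral_walk_law[symmetric] Phi_an_eq_energy
  by (intro Bochner_Integration.integral_cong) (auto simp: walk_eq_sum_list indicator_def)

end

section \<open>Superadditive sequences\<close>

text \<open>Fekete's lemma. The limit is the supremum of \<open>a n / real n\<close>, hence the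
  bound at every positive \<open>n\<close> and not only asymptotically.\<close>

lemma fekete_superadditive:
  fixes a :: "nat \<Rightarrow> real"
  assumes super: "\<And>m n. m \<ge> 1 \<Longrightarrow> n \<ge> 1 \<Longrightarrow> a m + a n \<le> a (m + n)"
    and bound: "\<And>n. n \<ge> 1 \<Longrightarrow> a n \<le> B * real n"
  obtains L where "(\<lambda>n. a n / real n) \<longlonglongrightarrow> L" "\<forall>n\<ge>1. a n \<le> L * real n" "L \<le> B"
proof -
  let ?L = "SUP n\<in>{1..}. a n / real n"
  have bdd: "bdd_above ((\<lambda>n. a n / real n) ` {1..})"
    using bound by (auto intro!: bdd_aboveI[where M = B] simp: field_simps)
  have upper: "a n / real n \<le> ?L" if "n \<ge> 1" for n
    using that by (intro cSUP_upper bdd) auto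
  have "(\<lambda>n. a n / real n) \<longlonglongrightarrow> ?L"
  proof (rule order_tendstoI)
    fix u assume "?L < u"
    then show "eventually (\<lambda>n. a n / real n < u) sequentially"
      using upper by (intro eventually_sequentiallyI[of 1]) (auto intro: le_less_trans)
  next
    fix l assume "l < ?L"
    then obtain m where m: "m \<ge> 1" "l < a m / real m"
      using bdd by (subst (asm) less_cSUP_iff) auto
    \<comment> \<open>The constant \<open>?C\<close> absorbs the last block, of length at most
      \<open>m\<close>, independently of \<open>n\<close>.\<close>
    define D where "D = Min (a ` {1..m})"
    let ?C = "\<bar>a m\<bar> - D"
    have mult: "real q * a m + a r \<le> a (q * m + r)" if "r \<ge> 1" for q r
    proof (induction q)
      case (Suc q)
      have "a m + a (q * m + r) \<le> a (m + (q * m + r))"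
        using m that by (intro super) auto
      then show ?case using Suc by (simp add: algebra_simps)
    qed simp
    have lower: "a m / real m - ?C / real n \<le> a n / real n" if "n \<ge> 1" for n
    proof -
      \<comment> \<open>The division is shifted by one so that the remainder \<open>r\<close> lies
        between 1 and \<open>m\<close>; superadditivity is assumed for positive arguments
        only.\<close>
      define q where "q = (n - 1) div m"
      define r where "r = (n - 1) mod m + 1"
      have n: "n = q * m + r" using that by (simp add: q_def r_def)
      have r: "1 \<le> r" "r \<le> m" using m by (auto simp: r_def Suc_le_eq)
      have "D \<le> a r" unfolding D_def using r by (intro Min_le) auto
      have "real r * (a m / real m) \<le> real r * (\<bar>a m\<bar> / real m)"
        by (intro mult_left_mono divide_right_mono) auto
      also have "\<dots> \<le> real m * (\<bar>a m\<bar> / real m)"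
        using r by (intro mult_right_mono) auto
      finally have "real r * (a m / real m) \<le> \<bar>a m\<bar>"
        using m by simp
      moreover have "real n * (a m / real m) = real q * a m + real r * (a m / real m)"
        using m by (simp add: n field_simps)
      ultimately have "real n * (a m / real m) - ?C \<le> a n"
        using mult[of r q] r \<open>D \<le> a r\<close> unfolding n by linarith
      then have "(real n * (a m / real m) - ?C) / real n \<le> a n / real n"
        by (intro divide_right_mono) auto
      then show ?thesis using that by (simp add: diff_divide_distrib)
    qed
    have "(\<lambda>n. a m / real m - ?C / real n) \<longlonglongrightarrow> a m / real m - 0"
      by (intro tendsto_intros tendsto_divide_0[OF tendsto_const] filterlim_at_top_imp_at_infinity filterlim_real_sequentially)
    then have "eventually (\<lambda>n. l < a m / real m - ?C / real n) sequentially"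
      using m by (intro order_tendstoD) auto
    then show "eventually (\<lambda>n. l < a n / real n) sequentially"
      using eventually_ge_at_top[of 1]
      by eventually_elim (use lower in \<open>force intro: less_le_trans\<close>)
  qed
  moreover have "a n \<le> ?L * real n" if "n \<ge> 1" for n
    using upper[OF that] that by (simp add: field_simps)
  moreover have "?L \<le> B"
    using bound by (intro cSUP_least) (auto simp: field_simps)
  ultimately show ?thesis using that by blast
qed

lemma tendsto_at_right_Inf:
  fixes g :: "real \<Rightarrow> real"
  assumes mono: "\<And>x y. a < x \<Longrightarrow> x \<le> y \<Longrightarrow> g x \<le> g y" and lower: "\<And>x. a < x \<Longrightarrow> c \<le> g x"
  shows "(g \<longlongrightarrow> (INF x\<in>{a<..}. g x)) (at_right a)"
proof (rule order_tendstoI)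
  have bdd: "bdd_below (g ` {a<..})"
    using lower by (auto intro!: bdd_belowI[where m = c])
  {
    fix l assume l: "l < (INF x\<in>{a<..}. g x)"
    have "l < g x" if "a < x" for x
      using l cINF_lower[OF bdd, of x] that by auto
    then show "eventually (\<lambda>x. l < g x) (at_right a)"
      by (auto simp: eventually_at_right_field intro!: exI[of _ "a + 1"])
  next
    fix u assume "(INF x\<in>{a<..}. g x) < u"
    then obtain y where "a < y" "g y < u"
      using bdd by (subst (asm) cINF_less_iff) auto
    then have "g x < u" if "a < x" "x < y" for x
      using mono[of x y] that by auto
    then show "eventually (\<lambda>x. g x < u) (at_right a)"
      using \<open>a < y\<close> by (auto simp: eventually_at_right_field)
  }
qed

section \<open>Crossing hyperplanes\<close>

text \<open>Time 0 counts as a visit, so only the empty path first hits the hyperplane at level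
  0.\<close>

definition first_hit :: "'d::finite \<Rightarrow> int \<Rightarrow> (int ^ 'd) list \<Rightarrow> bool" where
  "first_hit \<iota> L xs \<longleftrightarrow> sum_list xs $ \<iota> = L \<and> (\<forall>j<length xs. sum_list (take j xs) $ \<iota> \<noteq> L)"

lemma first_hit_exists:
  assumes "sum_list xs $ \<iota> = L"
  obtains j where "j \<le> length xs" "first_hit \<iota> L (take j xs)"
proof -
  define j where "j = (LEAST j. sum_list (take j xs) $ \<iota> = L)"
  have L: "sum_list (take (length xs) xs) $ \<iota> = L" using assms by simp
  have "sum_list (take j xs) $ \<iota> = L"
    unfolding j_def by (rule LeastI[of _ "length xs"]) (use L in simp)
  moreover have "j \<le> length xs" unfolding j_def using L by (rule Least_le)
  moreover have "sum_list (take i xs) $ \<iota> \<noteq> L" if "i < j" for i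
    using not_less_Least[of i "\<lambda>j. sum_list (take j xs) $ \<iota> = L"] that by (simp add: j_def)
  ultimately show ?thesis
    by (intro that[of j]) (auto simp: first_hit_def min_def)
qed

lemma first_hit_unique:
  assumes "first_hit \<iota> L (take i xs)" "first_hit \<iota> L (take j xs)" "i \<le> length xs" "j \<le> length xs"
  shows "i = j"
proof -
  have "\<not> i < j" if "first_hit \<iota> L (take i xs)" "first_hit \<iota> L (take j xs)" "j \<le> length xs" for i j
  proof
    assume "i < j"
    then have "sum_list (take i (take j xs)) $ \<iota> \<noteq> L"
      using that unfolding first_hit_def by auto
    then show False using that(1) \<open>i < j\<close> by (simp add: first_hit_def min_def)
  qed
  then show ?thesis using assms by (meson linorder_neqE_nat)
qed

lemma sum_first_hit_le_one:
  "(\<Sum>j\<le>length xs. of_bool (first_hit \<iota> L (take j xs)) :: real) \<le> 1"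
proof -
  have "card {j \<in> {..length xs}. first_hit \<iota> L (take j xs)} \<le> Suc 0"
    by (subst card_le_Suc0_iff_eq) (auto intro: first_hit_unique)
  then show ?thesis by (simp add: Int_def)
qed

context subadditive_potential
begin

definition plane_sum :: "'d::finite \<Rightarrow> real \<Rightarrow> nat \<Rightarrow> int \<Rightarrow> real" where
  "plane_sum \<iota> h n L = path_sum \<iota> h n (\<lambda>xs. of_bool (sum_list xs $ \<iota> = L) * exp (- energy \<phi> xs))"

definition hit_sum :: "'d::finite \<Rightarrow> real \<Rightarrow> nat \<Rightarrow> int \<Rightarrow> real" where
  "hit_sum \<iota> h n L = path_sum \<iota> h n (\<lambda>xs. of_bool (first_hit \<iota> L xs) * exp (- energy \<phi> xs))"

text \<open>The Green function of the weighted walk, from the origin to a hyperplane. The term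
  \<open>n = 0\<close>, absent from \<open>mbar_an_pos\<close>, is nonzero only for
  \<open>L = 0\<close>.\<close>

definition green :: "'d::finite \<Rightarrow> real \<Rightarrow> int \<Rightarrow> real" where
  "green \<iota> h L = (\<Sum>n. plane_sum \<iota> h n L)"

lemma plane_sum_nonneg [simp]: "plane_sum \<iota> h n L \<ge> 0"
  unfolding plane_sum_def by (intro path_sum_nonneg) auto

lemma hit_sum_nonneg [simp]: "hit_sum \<iota> h n L \<ge> 0"
  unfolding hit_sum_def by (intro path_sum_nonneg) auto

lemma hit_sum_le_plane_sum: "hit_sum \<iota> h n L \<le> plane_sum \<iota> h n L"
  unfolding hit_sum_def plane_sum_def by (intro path_sum_mono) (auto simp: first_hit_def)

lemma plane_sum_le: "plane_sum \<iota> h n L \<le> exp (h * of_int L) * (step_norm \<iota> 0 / step_norm \<iota> h) ^ n"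
proof -
  have "plane_sum \<iota> h n L \<le> path_sum \<iota> h n (\<lambda>xs. of_bool (sum_list xs $ \<iota> = L))"
    unfolding plane_sum_def by (intro path_sum_mono) (auto simp: energy_nonneg)
  also note path_sum_return
  finally show ?thesis .
qed

text \<open>On a fixed hyperplane the drift enters the path weights only through a factor depending
  on \<open>n\<close> and \<open>L\<close>.\<close>

lemma plane_sum_tilt:
  "plane_sum \<iota> h n L = exp (h * of_int L) * (step_norm \<iota> 0 / step_norm \<iota> h) ^ n * plane_sum \<iota> 0 n L"
  unfolding plane_sum_def path_sum_def sum_distrib_left
  by (intro sum.cong) (auto simp: path_weight_def length_paths power_divide step_norm_pos less_imp_neq[symmetric])

lemma sum_plane_sum_le: "finite A \<Longrightarrow> (\<Sum>L\<in>A. plane_sum \<iota> h n L) \<le> partition_fn \<iota> h n"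
proof -
  assume "finite A"
  have "(\<Sum>L\<in>A. plane_sum \<iota> h n L) =
      path_sum \<iota> h n (\<lambda>xs. \<Sum>L\<in>A. of_bool (sum_list xs $ \<iota> = L) * exp (- energy \<phi> xs))"
    by (simp add: plane_sum_def path_sum_sum)
  also have "\<dots> = path_sum \<iota> h n (\<lambda>xs. of_bool (sum_list xs $ \<iota> \<in> A) * exp (- energy \<phi> xs))"
  proof (intro path_sum_cong)
    fix xs :: "(int ^ 'a) list"
    have "(\<Sum>L\<in>A. of_bool (sum_list xs $ \<iota> = L) * exp (- energy \<phi> xs)) =
        (\<Sum>L\<in>A. if sum_list xs $ \<iota> = L then exp (- energy \<phi> xs) else 0)"
      by (intro sum.cong) auto
    then show "(\<Sum>L\<in>A. of_bool (sum_list xs $ \<iota> = L) * exp (- energy \<phi> xs)) =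
        of_bool (sum_list xs $ \<iota> \<in> A) * exp (- energy \<phi> xs)"
      using \<open>finite A\<close> by simp
  qed
  also have "\<dots> \<le> partition_fn \<iota> h n"
    unfolding partition_fn_def by (intro path_sum_mono) auto
  finally show ?thesis .
qed

text \<open>A path ending in the hyperplane is cut at its first visit there. The energy of the rest
  is dropped, and its return to the hyperplane is bounded by \<open>path_sum_return\<close>.\<close>

lemma plane_sum_le_convolution:
  "plane_sum \<iota> h n L \<le> (\<Sum>j\<le>n. hit_sum \<iota> h j L * (step_norm \<iota> 0 / step_norm \<iota> h) ^ (n - j))"
proof -
  have "plane_sum \<iota> h n L \<le> path_sum \<iota> h n (\<lambda>xs. \<Sum>j\<le>n.
      of_bool (first_hit \<iota> L (take j xs)) * of_bool (sum_list (drop j xs) $ \<iota> = 0) * exp (- energy \<phi> (take j xs)))"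
    unfolding plane_sum_def
  proof (rule path_sum_mono)
    fix xs :: "(int ^ 'a) list" assume xs: "xs \<in> paths n"
    let ?t = "\<lambda>j. of_bool (first_hit \<iota> L (take j xs)) * of_bool (sum_list (drop j xs) $ \<iota> = 0) *
      exp (- energy \<phi> (take j xs)) :: real"
    show "of_bool (sum_list xs $ \<iota> = L) * exp (- energy \<phi> xs) \<le> (\<Sum>j\<le>n. ?t j)"
    proof (cases "sum_list xs $ \<iota> = L")
      case True
      then obtain j where j: "j \<le> n" "first_hit \<iota> L (take j xs)"
        using first_hit_exists[of xs \<iota> L] xs by (auto simp: length_paths)
      have "sum_list xs = sum_list (take j xs) + sum_list (drop j xs)"
        by (metis append_take_drop_id sum_list_append)
      then have "?t j = exp (- energy \<phi> (take j xs))"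
        using j True by (auto simp: first_hit_def)
      moreover have "?t j \<le> (\<Sum>j\<le>n. ?t j)"
        using j by (intro member_le_sum) auto
      moreover have "exp (- energy \<phi> xs) \<le> exp (- energy \<phi> (take j xs))"
        using energy_prefix[of "take j xs" "drop j xs"] by simp
      ultimately have "exp (- energy \<phi> xs) \<le> (\<Sum>j\<le>n. ?t j)" by linarith
      then show ?thesis using True by simp
    qed (auto intro!: sum_nonneg)
  qed
  also have "\<dots> = (\<Sum>j\<le>n. path_sum \<iota> h n (\<lambda>xs.
      of_bool (first_hit \<iota> L (take j xs)) * of_bool (sum_list (drop j xs) $ \<iota> = 0) * exp (- energy \<phi> (take j xs))))"
    by (rule path_sum_sum)
  also have "\<dots> \<le> (\<Sum>j\<le>n. hit_sum \<iota> h j L * (step_norm \<iota> 0 / step_norm \<iota> h) ^ (n - j))"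
  proof (rule sum_mono)
    fix j assume "j \<in> {..n}"
    then have "n = j + (n - j)" by simp
    then have "path_sum \<iota> h n (\<lambda>xs. of_bool (first_hit \<iota> L (take j xs)) *
          of_bool (sum_list (drop j xs) $ \<iota> = 0) * exp (- energy \<phi> (take j xs))) =
        path_sum \<iota> h j (\<lambda>ys. path_sum \<iota> h (n - j) (\<lambda>zs.
          of_bool (first_hit \<iota> L ys) * exp (- energy \<phi> ys) * of_bool (sum_list zs $ \<iota> = 0)))"
      using path_sum_append[of \<iota> h j "n - j" "\<lambda>xs. of_bool (first_hit \<iota> L (take j xs)) *
          of_bool (sum_list (drop j xs) $ \<iota> = 0) * exp (- energy \<phi> (take j xs))"]
      by (auto simp: length_paths mult_ac intro!: path_sum_cong)
    also have "\<dots> = hit_sum \<iota> h j L * path_sum \<iota> h (n - j) (\<lambda>zs. of_bool (sum_list zs $ \<iota> = 0))"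
      by (simp only: path_sum_cmult path_sum_cmult_right hit_sum_def)
    also have "\<dots> \<le> hit_sum \<iota> h j L * (step_norm \<iota> 0 / step_norm \<iota> h) ^ (n - j)"
      using path_sum_return[of \<iota> h "n - j" 0] by (intro mult_left_mono hit_sum_nonneg) auto
    finally show "path_sum \<iota> h n (\<lambda>xs. of_bool (first_hit \<iota> L (take j xs)) *
          of_bool (sum_list (drop j xs) $ \<iota> = 0) * exp (- energy \<phi> (take j xs))) \<le>
        hit_sum \<iota> h j L * (step_norm \<iota> 0 / step_norm \<iota> h) ^ (n - j)" .
  qed
  finally show ?thesis .
qed

text \<open>Gluing two paths costs at most the sum of their energies. The cut is the first hitting
  time of level \<open>L\<close>, so each glued path arises at most once.\<close>

lemma convolution_le_plane_sum:
  "(\<Sum>j\<le>n. hit_sum \<iota> h j L * plane_sum \<iota> h (n - j) K) \<le> plane_sum \<iota> h n (L + K)"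
proof -
  have "(\<Sum>j\<le>n. hit_sum \<iota> h j L * plane_sum \<iota> h (n - j) K) \<le>
      (\<Sum>j\<le>n. path_sum \<iota> h n (\<lambda>xs. of_bool (first_hit \<iota> L (take j xs)) *
        (of_bool (sum_list xs $ \<iota> = L + K) * exp (- energy \<phi> xs))))"
  proof (rule sum_mono)
    fix j assume "j \<in> {..n}"
    then have n: "n = j + (n - j)" by simp
    have "hit_sum \<iota> h j L * plane_sum \<iota> h (n - j) K =
        path_sum \<iota> h j (\<lambda>ys. path_sum \<iota> h (n - j) (\<lambda>zs. of_bool (first_hit \<iota> L ys) * exp (- energy \<phi> ys) *
          (of_bool (sum_list zs $ \<iota> = K) * exp (- energy \<phi> zs))))"
      by (simp only: path_sum_cmult path_sum_cmult_right hit_sum_def plane_sum_def)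
    also have "\<dots> \<le> path_sum \<iota> h (j + (n - j)) (\<lambda>xs. of_bool (first_hit \<iota> L (take j xs)) *
        (of_bool (sum_list xs $ \<iota> = L + K) * exp (- energy \<phi> xs)))"
      unfolding path_sum_append
    proof (intro path_sum_mono)
      fix ys zs :: "(int ^ 'a) list" assume "ys \<in> paths j"
      have "exp (- energy \<phi> ys) * exp (- energy \<phi> zs) \<le> exp (- energy \<phi> (ys @ zs))"
        using energy_append[of ys zs] by (simp add: exp_add[symmetric])
      then show "of_bool (first_hit \<iota> L ys) * exp (- energy \<phi> ys) * (of_bool (sum_list zs $ \<iota> = K) * exp (- energy \<phi> zs)) \<le>
          of_bool (first_hit \<iota> L (take j (ys @ zs))) *
            (of_bool (sum_list (ys @ zs) $ \<iota> = L + K) * exp (- energy \<phi> (ys @ zs)))"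
        using \<open>ys \<in> paths j\<close> by (auto simp: length_paths first_hit_def)
    qed
    finally show "hit_sum \<iota> h j L * plane_sum \<iota> h (n - j) K \<le>
        path_sum \<iota> h n (\<lambda>xs. of_bool (first_hit \<iota> L (take j xs)) *
        (of_bool (sum_list xs $ \<iota> = L + K) * exp (- energy \<phi> xs)))"
      using n by simp
  qed
  also have "\<dots> = path_sum \<iota> h n (\<lambda>xs. (\<Sum>j\<le>n. of_bool (first_hit \<iota> L (take j xs))) *
      (of_bool (sum_list xs $ \<iota> = L + K) * exp (- energy \<phi> xs)))"
    by (simp only: path_sum_sum sum_distrib_right)
  also have "\<dots> \<le> plane_sum \<iota> h n (L + K)"
    unfolding plane_sum_def
  proof (rule path_sum_mono)
    fix xs :: "(int ^ 'a) list" assume "xs \<in> paths n"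
    then have "(\<Sum>j\<le>n. of_bool (first_hit \<iota> L (take j xs)) :: real) \<le> 1"
      using sum_first_hit_le_one[of \<iota> L xs] by (simp add: length_paths)
    from mult_right_mono[OF this, of "of_bool (sum_list xs $ \<iota> = L + K) * exp (- energy \<phi> xs)"]
    show "(\<Sum>j\<le>n. of_bool (first_hit \<iota> L (take j xs))) * (of_bool (sum_list xs $ \<iota> = L + K) * exp (- energy \<phi> xs)) \<le>
        of_bool (sum_list xs $ \<iota> = L + K) * exp (- energy \<phi> xs)"
      by simp
  qed
  finally show ?thesis .
qed

section \<open>Summation over the path length\<close>

lemma return_ratio:
  fixes \<iota> :: "'d::finite"
  assumes "h > 0"
  shows "0 < step_norm \<iota> 0 / step_norm \<iota> h" "step_norm \<iota> 0 / step_norm \<iota> h < 1"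
  using step_norm_strict_mono[of 0 h \<iota>] assms by (simp_all add: step_norm_pos)

lemma summable_plane_sum:
  assumes "h > 0"
  shows "summable (\<lambda>n. plane_sum \<iota> h n L)"
proof (rule summable_comparison_test')
  show "summable (\<lambda>n. exp (h * of_int L) * (step_norm \<iota> 0 / step_norm \<iota> h) ^ n)"
    using return_ratio[OF assms, of \<iota>] by (intro summable_mult summable_geometric) auto
  show "norm (plane_sum \<iota> h n L) \<le> exp (h * of_int L) * (step_norm \<iota> 0 / step_norm \<iota> h) ^ n" for n
    using plane_sum_le[of \<iota> h n L] by simp
qed

lemma green_Suc:
  assumes "h > 0" "L \<noteq> 0"
  shows "green \<iota> h L = (\<Sum>n. plane_sum \<iota> h (Suc n) L)"
proof -
  have "plane_sum \<iota> h 0 L = 0"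
    using assms by (simp add: plane_sum_def path_sum_def)
  then show ?thesis
    using suminf_split_head[OF summable_plane_sum[OF assms(1), of \<iota> L]] by (simp add: green_def)
qed

lemma green_le:
  assumes "h > 0"
  shows "green \<iota> h L \<le> exp (h * of_int L) * (1 / (1 - step_norm \<iota> 0 / step_norm \<iota> h))"
proof -
  let ?q = "step_norm \<iota> 0 / step_norm \<iota> h"
  have q: "norm ?q < 1" using return_ratio[OF assms, of \<iota>] by auto
  have "green \<iota> h L \<le> (\<Sum>n. exp (h * of_int L) * ?q ^ n)"
    unfolding green_def
    using q by (intro suminf_le plane_sum_le summable_plane_sum assms summable_mult summable_geometric)
  also have "\<dots> = exp (h * of_int L) * (1 / (1 - ?q))"
    using q by (simp only: suminf_mult summable_geometric suminf_geometric)
  finally show ?thesis .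
qed

text \<open>Summed over the path length, both convolution bounds become Cauchy products. The first
  replaces \<open>green \<iota> h L\<close> by the sum of \<open>hit_sum\<close>, at the cost of a
  geometric series in the loop ratio; the second joins hits of level \<open>L\<close> to paths
  advancing by \<open>K\<close>.\<close>

lemma green_mult_le:
  assumes "h > 0"
  shows "green \<iota> h L * green \<iota> h K \<le> 1 / (1 - step_norm \<iota> 0 / step_norm \<iota> h) * green \<iota> h (L + K)"
proof -
  let ?q = "step_norm \<iota> 0 / step_norm \<iota> h"
  have q: "0 < ?q" "norm ?q < 1" using return_ratio[OF assms, of \<iota>] by auto
  have sg: "summable (\<lambda>n. norm (plane_sum \<iota> h n L))" for L
    using summable_plane_sum[OF assms, of \<iota> L] by simp
  have sh: "summable (\<lambda>n. norm (hit_sum \<iota> h n L))"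
    by (rule summable_comparison_test'[OF summable_plane_sum[OF assms, of \<iota> L]])
       (simp add: hit_sum_le_plane_sum)
  have sq: "summable (\<lambda>n. norm (?q ^ n))"
    using q by (simp add: norm_power)
  have "green \<iota> h L \<le> (\<Sum>n. \<Sum>j\<le>n. hit_sum \<iota> h j L * ?q ^ (n - j))"
    unfolding green_def
    by (intro suminf_le plane_sum_le_convolution summable_plane_sum assms summable_Cauchy_product sh sq)
  also have "\<dots> = (\<Sum>n. hit_sum \<iota> h n L) * (1 / (1 - ?q))"
    using Cauchy_product[OF sh sq] q by (simp only: suminf_geometric)
  finally have "green \<iota> h L * green \<iota> h K \<le> (\<Sum>n. hit_sum \<iota> h n L) * (1 / (1 - ?q)) * green \<iota> h K"
    unfolding green_def
    by (intro mult_right_mono suminf_nonneg summable_plane_sum assms plane_sum_nonneg) simp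
  also have "\<dots> = 1 / (1 - ?q) * ((\<Sum>n. hit_sum \<iota> h n L) * (\<Sum>n. plane_sum \<iota> h n K))"
    by (simp add: green_def)
  also have "\<dots> \<le> 1 / (1 - ?q) * green \<iota> h (L + K)"
  proof (intro mult_left_mono)
    have "(\<Sum>n. hit_sum \<iota> h n L) * (\<Sum>n. plane_sum \<iota> h n K) =
        (\<Sum>n. \<Sum>j\<le>n. hit_sum \<iota> h j L * plane_sum \<iota> h (n - j) K)"
      by (rule Cauchy_product[OF sh sg])
    also have "\<dots> \<le> green \<iota> h (L + K)"
      unfolding green_def
      by (intro suminf_le convolution_le_plane_sum summable_plane_sum assms summable_Cauchy_product sh sg)
    finally show "(\<Sum>n. hit_sum \<iota> h n L) * (\<Sum>n. plane_sum \<iota> h n K) \<le> green \<iota> h (L + K)" .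
  qed (use return_ratio[OF assms, of \<iota>] in simp)
  finally show ?thesis .
qed

lemma green_pos:
  fixes \<iota> :: "'d::finite"
  assumes "h > 0"
  shows "green \<iota> h (int L) > 0"
  unfolding green_def
proof (rule suminf_pos2[where i = L])
  let ?xs = "replicate L (axis \<iota> 1) :: (int ^ 'd) list"
  have "sum_list ?xs $ \<iota> = int L"
    by (induction L) simp_all
  then have "0 < path_weight \<iota> h ?xs * (of_bool (sum_list ?xs $ \<iota> = int L) * exp (- energy \<phi> ?xs))"
    by (simp add: path_weight_pos)
  also have "\<dots> \<le> plane_sum \<iota> h L (int L)"
    unfolding plane_sum_def path_sum_def by (rule member_le_sum) (auto simp: replicate_paths)
  finally show "plane_sum \<iota> h L (int L) > 0" .
qed (auto intro: summable_plane_sum assms plane_sum_nonneg)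

text \<open>Division by the constant of \<open>green_mult_le\<close> yields a supermultiplicative
  sequence, to whose logarithm Fekete's lemma applies. The correction \<open>ln C / real L\<close>
  vanishes, and \<open>green_le\<close> gives \<open>l \<le> h\<close>.\<close>

lemma green_limit:
  assumes "h > 0"
  obtains l where "(\<lambda>L. ln (green \<iota> h (int L)) / real L) \<longlonglongrightarrow> l" "l \<le> h"
proof -
  define C where "C = 1 / (1 - step_norm \<iota> 0 / step_norm \<iota> h)"
  have C: "C > 0" using return_ratio[OF assms, of \<iota>] by (simp add: C_def)
  let ?a = "\<lambda>L. ln (green \<iota> h (int L) / C)"
  have super: "?a m + ?a n \<le> ?a (m + n)" for m n
  proof -
    have "?a m + ?a n = ln (green \<iota> h (int m) / C * (green \<iota> h (int n) / C))"
      by (rule ln_mult_pos[symmetric]) (simp_all add: C green_pos assms)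
    also have "\<dots> \<le> ?a (m + n)"
    proof (intro iffD2[OF ln_le_cancel_iff] mult_pos_pos divide_pos_pos green_pos assms C)
      show "green \<iota> h (int m) / C * (green \<iota> h (int n) / C) \<le> green \<iota> h (int (m + n)) / C"
        using green_mult_le[OF assms, of \<iota> "int m" "int n"] C
        unfolding C_def[symmetric] by (simp add: field_simps)
    qed
    finally show ?thesis .
  qed
  have bound: "?a n \<le> h * real n" for n
  proof -
    have "?a n \<le> ln (exp (h * real n))"
      using green_le[OF assms, of \<iota> "int n"] C green_pos[OF assms]
      unfolding C_def[symmetric] by (subst ln_le_cancel_iff) (auto simp: field_simps)
    then show ?thesis by simp
  qed
  obtain l where l: "(\<lambda>L. ?a L / real L) \<longlonglongrightarrow> l" "l \<le> h"
    by (rule fekete_superadditive[of ?a h, OF super bound])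
  have "(\<lambda>L. ?a L / real L + ln C / real L) \<longlonglongrightarrow> l + 0"
    by (intro tendsto_add l tendsto_divide_0[OF tendsto_const] filterlim_at_top_imp_at_infinity filterlim_real_sequentially)
  moreover have "?a L / real L + ln C / real L = ln (green \<iota> h (int L)) / real L" for L
    using C green_pos[OF assms, of \<iota> L] by (simp add: ln_div diff_divide_distrib)
  ultimately show ?thesis using l that by simp
qed

section \<open>The crossing rate as a function of the drift\<close>

definition crossing_rate :: "'d::finite \<Rightarrow> real \<Rightarrow> real" where
  "crossing_rate \<iota> h = - lim (\<lambda>L. ln (green \<iota> h (int L)) / real L)"

lemma crossing_rate_tendsto:
  "h > 0 \<Longrightarrow> (\<lambda>L. - (ln (green \<iota> h (int L)) / real L)) \<longlonglongrightarrow> crossing_rate \<iota> h"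
  unfolding crossing_rate_def by (rule green_limit[of h \<iota>]) (auto simp: limI intro: tendsto_minus)

lemma crossing_rate_ge: "h > 0 \<Longrightarrow> crossing_rate \<iota> h \<ge> - h"
  unfolding crossing_rate_def by (rule green_limit[of h \<iota>]) (auto simp: limI)

text \<open>By \<open>plane_sum_tilt\<close>, once the exponential factor is removed the drift
  enters only through powers of the loop ratio, which decreases in the drift.\<close>

lemma green_tilt_antimono:
  assumes "0 < h" "h \<le> h'"
  shows "exp (- (h' * of_int L)) * green \<iota> h' L \<le> exp (- (h * of_int L)) * green \<iota> h L"
proof -
  have norm: "step_norm \<iota> h \<le> step_norm \<iota> h'"
    using step_norm_strict_mono[of h h' \<iota>] assms by (cases "h = h'") auto
  have "exp (- (h' * of_int L)) * plane_sum \<iota> h' n L \<le> exp (- (h * of_int L)) * plane_sum \<iota> h n L" for n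
  proof -
    have "(step_norm \<iota> 0 / step_norm \<iota> h') ^ n * plane_sum \<iota> 0 n L \<le> (step_norm \<iota> 0 / step_norm \<iota> h) ^ n * plane_sum \<iota> 0 n L"
      using norm by (intro mult_right_mono power_mono divide_left_mono mult_pos_pos step_norm_pos plane_sum_nonneg)
        (auto simp: step_norm_pos less_imp_le)
    then show ?thesis
      unfolding plane_sum_tilt[of \<iota> h] plane_sum_tilt[of \<iota> h'] by (simp add: mult.assoc[symmetric] exp_add[symmetric])
  qed
  then show ?thesis
    unfolding green_def using assms
    by (subst (1 2) suminf_mult[symmetric]) (auto intro!: suminf_le summable_mult summable_plane_sum)
qed

lemma crossing_rate_mono:
  assumes "0 < h" "h \<le> h'"
  shows "crossing_rate \<iota> h + h \<le> crossing_rate \<iota> h' + h'"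
proof (rule LIMSEQ_le)
  show "(\<lambda>L. - (ln (green \<iota> h (int L)) / real L) + h) \<longlonglongrightarrow> crossing_rate \<iota> h + h"
    "(\<lambda>L. - (ln (green \<iota> h' (int L)) / real L) + h') \<longlonglongrightarrow> crossing_rate \<iota> h' + h'"
    using assms by (intro tendsto_add crossing_rate_tendsto tendsto_const; simp)+
  have "- (ln (green \<iota> h (int L)) / real L) + h \<le> - (ln (green \<iota> h' (int L)) / real L) + h'" if "L \<ge> 1" for L
  proof -
    have "ln (exp (- (h' * real L)) * green \<iota> h' (int L)) \<le> ln (exp (- (h * real L)) * green \<iota> h (int L))"
      using green_tilt_antimono[OF assms, of "int L" \<iota>] green_pos[of _ \<iota> L] assms
      by (subst ln_le_cancel_iff) auto
    then have "- (h' * real L) + ln (green \<iota> h' (int L)) \<le> - (h * real L) + ln (green \<iota> h (int L))"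
      using assms by (simp add: ln_mult_pos green_pos)
    then have "(- (h' * real L) + ln (green \<iota> h' (int L))) / real L \<le> (- (h * real L) + ln (green \<iota> h (int L))) / real L"
      by (rule divide_right_mono) simp
    then show ?thesis using that by (simp add: add_divide_distrib diff_divide_distrib)
  qed
  then show "\<exists>N. \<forall>n\<ge>N. - (ln (green \<iota> h (int n)) / real n) + h \<le> - (ln (green \<iota> h' (int n)) / real n) + h'"
    by blast
qed

text \<open>The sum \<open>crossing_rate \<iota> h + h\<close> is nondecreasing and nonnegative, so
  it tends to its infimum, and the added \<open>h\<close> vanishes in the limit.\<close>

lemma crossing_rate_tendsto_at_0:
  "(crossing_rate \<iota> \<longlongrightarrow> (INF h\<in>{0<..}. crossing_rate \<iota> h + h)) (at_right 0)"
proof -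
  have "((\<lambda>h. crossing_rate \<iota> h + h) \<longlongrightarrow> (INF h\<in>{0<..}. crossing_rate \<iota> h + h)) (at_right 0)"
    by (rule tendsto_at_right_Inf[where c = 0]) (use crossing_rate_mono crossing_rate_ge[of _ \<iota>] in fastforce)+
  then have "((\<lambda>h. crossing_rate \<iota> h + h - h) \<longlongrightarrow> (INF h\<in>{0<..}. crossing_rate \<iota> h + h) - 0) (at_right 0)"
    by (intro tendsto_diff) auto
  then show ?thesis by simp
qed

text \<open>Restricted to the hyperplane at level \<open>L\<close>, the series is
  \<open>exp ((h - h') * real L) * green \<iota> h' (int L)\<close>. The rate condition makes this
  at least 1 for all large \<open>L\<close>, and \<open>partition_fn\<close> dominates the sum over
  any finite set of hyperplanes.\<close>

lemma not_summable_partition: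
  fixes \<iota> :: "'d::finite"
  assumes "0 < h'" and rate: "crossing_rate \<iota> h' + h' < h"
  shows "\<not> summable (\<lambda>n. (step_norm \<iota> h / step_norm \<iota> h') ^ n * partition_fn \<iota> h n)"
proof
  let ?t = "step_norm \<iota> h / step_norm \<iota> h'"
  assume summable: "summable (\<lambda>n. ?t ^ n * partition_fn \<iota> h n)"
  have tilt: "?t ^ n * plane_sum \<iota> h n L = exp ((h - h') * of_int L) * plane_sum \<iota> h' n L" for n L
    unfolding plane_sum_tilt[of \<iota> h] plane_sum_tilt[of \<iota> h']
    by (simp add: power_divide step_norm_pos less_imp_neq[symmetric] left_diff_distrib exp_diff)
  have summable_plane: "summable (\<lambda>n. ?t ^ n * plane_sum \<iota> h n L)" for L
    unfolding tilt by (intro summable_mult summable_plane_sum assms)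
  have "eventually (\<lambda>L. - (ln (green \<iota> h' (int L)) / real L) < h - h') sequentially"
    using rate by (intro order_tendstoD[OF crossing_rate_tendsto[OF \<open>0 < h'\<close>, of \<iota>]]) simp
  then obtain L0 where "\<And>L. L \<ge> L0 \<Longrightarrow> - (ln (green \<iota> h' (int L)) / real L) < h - h'"
    by (auto simp: eventually_sequentially)
  \<comment> \<open>Starting at \<open>Suc L0\<close> ensures \<open>L > 0\<close>, so that the
    division by \<open>real L\<close> can be undone.\<close>
  then have L0: "1 \<le> exp ((h - h') * real L) * green \<iota> h' (int L)" if "L \<ge> Suc L0" for L
  proof -
    have "- (ln (green \<iota> h' (int L)) / real L) < h - h'"
      using \<open>\<And>L. L \<ge> L0 \<Longrightarrow> - (ln (green \<iota> h' (int L)) / real L) < h - h'\<close>[of L] that by simp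
    then have "0 < (h - h') * real L + ln (green \<iota> h' (int L))"
      using that by (simp add: field_simps)
    then have "exp 0 < exp ((h - h') * real L + ln (green \<iota> h' (int L)))"
      by (subst exp_less_cancel_iff)
    then show ?thesis using green_pos[OF \<open>0 < h'\<close>, of \<iota> L] by (simp add: exp_add)
  qed
  define B where "B = (\<Sum>n. ?t ^ n * partition_fn \<iota> h n)"
  \<comment> \<open>The \<open>m\<close> consecutive hyperplanes from level \<open>Suc L0\<close> on
    contribute at least 1 each.\<close>
  have "real m \<le> B" for m
  proof -
    let ?A = "int ` {Suc L0..<Suc L0 + m}"
    have "real m = (\<Sum>L\<in>{Suc L0..<Suc L0 + m}. 1)" by simp
    also have "\<dots> \<le> (\<Sum>L\<in>{Suc L0..<Suc L0 + m}. exp ((h - h') * real L) * green \<iota> h' (int L))"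
      by (intro sum_mono L0) simp
    also have "\<dots> = (\<Sum>L\<in>?A. exp ((h - h') * of_int L) * green \<iota> h' L)"
      by (subst sum.reindex) (auto simp: inj_on_def)
    also have "\<dots> = (\<Sum>L\<in>?A. \<Sum>n. ?t ^ n * plane_sum \<iota> h n L)"
      unfolding green_def tilt by (intro sum.cong refl suminf_mult[symmetric] summable_plane_sum assms)
    also have "\<dots> = (\<Sum>n. \<Sum>L\<in>?A. ?t ^ n * plane_sum \<iota> h n L)"
      by (rule suminf_sum[symmetric]) (rule summable_plane)
    also have "\<dots> \<le> B"
      unfolding B_def
    proof (intro suminf_le summable summable_sum summable_plane)
      fix n
      show "(\<Sum>L\<in>?A. ?t ^ n * plane_sum \<iota> h n L) \<le> ?t ^ n * partition_fn \<iota> h n"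
        unfolding sum_distrib_left[symmetric]
        by (intro mult_left_mono sum_plane_sum_le) (auto simp: step_norm_pos less_imp_le)
    qed
    finally show ?thesis .
  qed
  then show False using reals_Archimedean2[of B] by (auto simp: not_le[symmetric])
qed

text \<open>Fekete's lemma is applied to the logarithms, which are at most 0. Because the limit is a
  supremum, the exponential bound holds at every \<open>N\<close> without a constant.\<close>

lemma partition_limit:
  obtains m where "(\<lambda>N. ln (partition_fn \<iota> h N) / real N) \<longlonglongrightarrow> - m" "\<And>N. partition_fn \<iota> h N \<le> exp (- m * real N)"
proof -
  have le1: "partition_fn \<iota> h n \<le> 1" for n
    using path_sum_mono[of n "\<lambda>xs. exp (- energy \<phi> xs)" "\<lambda>_. 1" \<iota> h] path_sum_one[of \<iota> h n]
    by (auto simp: partition_fn_def energy_nonneg)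
  let ?a = "\<lambda>n. ln (partition_fn \<iota> h n)"
  have super: "?a m + ?a n \<le> ?a (m + n)" for m n
    using partition_mult_le[of \<iota> h m n]
    by (simp add: ln_mult_pos[symmetric] partition_pos ln_le_cancel_iff)
  have bound: "?a n \<le> 0 * real n" for n
    using le1[of n] partition_pos[of \<iota> h n] by (simp add: ln_le_zero_iff)
  obtain l where l: "(\<lambda>n. ?a n / real n) \<longlonglongrightarrow> l" "\<forall>n\<ge>1. ?a n \<le> l * real n"
    by (rule fekete_superadditive[of ?a 0, OF super bound])
  have "partition_fn \<iota> h n \<le> exp (- (- l) * real n)" for n
  proof (cases "n \<ge> 1")
    case True
    then have "exp (?a n) \<le> exp (l * real n)" using l(2) by simp
    then show ?thesis using partition_pos[of \<iota> h n] by simp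
  next
    case False
    then have "n = 0" by simp
    then show ?thesis using le1[of 0] by simp
  qed
  then show ?thesis using l(1) that[of "- l"] by simp
qed

text \<open>Otherwise the series of \<open>not_summable_partition\<close> would be dominated by a
  geometric series whose ratio is at most the loop ratio for \<open>h'\<close>, which is below
  1.\<close>

lemma rate_less_if_crossing_rate_less:
  fixes \<iota> :: "'d::finite"
  assumes "0 < h'" "crossing_rate \<iota> h' + h' < h" and upper: "\<And>N. partition_fn \<iota> h N \<le> exp (- m * real N)"
  shows "step_norm \<iota> 0 / step_norm \<iota> h < exp (- m)"
proof (rule ccontr)
  assume "\<not> ?thesis"
  then have m: "exp (- m) \<le> step_norm \<iota> 0 / step_norm \<iota> h" by simp
  let ?t = "step_norm \<iota> h / step_norm \<iota> h'"
  have "?t * exp (- m) \<le> ?t * (step_norm \<iota> 0 / step_norm \<iota> h)"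
    using m by (intro mult_left_mono) (auto simp: step_norm_pos less_imp_le)
  also have "\<dots> = step_norm \<iota> 0 / step_norm \<iota> h'"
    using step_norm_pos[of \<iota> h] by simp
  also have "\<dots> < 1" by (rule return_ratio[OF \<open>0 < h'\<close>])
  finally have t: "?t * exp (- m) < 1" .
  have "summable (\<lambda>n. (?t * exp (- m)) ^ n)"
    using t by (intro summable_geometric) (simp add: step_norm_pos less_imp_le abs_mult)
  then have "summable (\<lambda>n. ?t ^ n * partition_fn \<iota> h n)"
  proof (rule summable_comparison_test')
    fix n
    have "?t ^ n * partition_fn \<iota> h n \<le> ?t ^ n * exp (- m * real n)"
      by (intro mult_left_mono upper) (simp add: step_norm_pos less_imp_le)
    also have "exp (- m * real n) = exp (- m) ^ n" by (subst exp_of_nat2_mult[symmetric]) simp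
    finally have "?t ^ n * partition_fn \<iota> h n \<le> (?t * exp (- m)) ^ n"
      by (simp only: power_mult_distrib)
    then show "norm (?t ^ n * partition_fn \<iota> h n) \<le> (?t * exp (- m)) ^ n"
      by (subst real_norm_def, subst abs_of_nonneg) (simp_all add: step_norm_pos partition_pos less_imp_le)
  qed
  then show False using not_summable_partition assms by blast
qed

end

section \<open>Monotonicity in the potential\<close>

lemma energy_mono_potential: "(\<And>n. \<phi> n \<le> \<psi> n) \<Longrightarrow> energy \<phi> xs \<le> energy \<psi> xs"
  unfolding energy_def by (intro sum_mono)

lemma partition_antimono_potential:
  assumes "subadditive_potential \<phi>" "subadditive_potential \<psi>" "\<And>n. \<phi> n \<le> \<psi> n"
  shows "subadditive_potential.partition_fn \<psi> \<iota> h n \<le> subadditive_potential.partition_fn \<phi> \<iota> h n"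
  unfolding subadditive_potential.partition_fn_def[OF assms(1)] subadditive_potential.partition_fn_def[OF assms(2)]
  by (intro path_sum_mono) (use energy_mono_potential[of \<phi> \<psi>] assms(3) in auto)

lemma crossing_rate_mono_potential:
  assumes "subadditive_potential \<phi>" "subadditive_potential \<psi>" "\<And>n. \<phi> n \<le> \<psi> n" "h > 0"
  shows "subadditive_potential.crossing_rate \<phi> \<iota> h \<le> subadditive_potential.crossing_rate \<psi> \<iota> h"
proof -
  interpret \<phi>: subadditive_potential \<phi> by fact
  interpret \<psi>: subadditive_potential \<psi> by fact
  have "\<psi>.plane_sum \<iota> h n L \<le> \<phi>.plane_sum \<iota> h n L" for n L
    unfolding \<phi>.plane_sum_def \<psi>.plane_sum_def
    by (intro path_sum_mono) (use energy_mono_potential[of \<phi> \<psi>] assms(3) in auto)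
  then have "\<psi>.green \<iota> h L \<le> \<phi>.green \<iota> h L" for L
    unfolding \<phi>.green_def \<psi>.green_def
    by (intro suminf_le \<phi>.summable_plane_sum \<psi>.summable_plane_sum assms)
  then have "- (ln (\<phi>.green \<iota> h (int L)) / real L) \<le> - (ln (\<psi>.green \<iota> h (int L)) / real L)" for L
    using \<phi>.green_pos[OF \<open>h > 0\<close>, of \<iota> L] \<psi>.green_pos[OF \<open>h > 0\<close>, of \<iota> L]
    by (auto intro!: divide_right_mono)
  then show ?thesis
    by (intro LIMSEQ_le[OF \<phi>.crossing_rate_tendsto[OF \<open>h > 0\<close>] \<psi>.crossing_rate_tendsto[OF \<open>h > 0\<close>]]) auto
qed

section \<open>The annealed rates\<close>

context iid_nonneg_potential
begin

lemma Z_an_eq_partition: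
  "\<beta> \<ge> 0 \<Longrightarrow> Z_an M V \<iota> h \<beta> N = subadditive_potential.partition_fn (\<lambda>n. phi_an M V \<beta> (real n)) \<iota> h N"
  unfolding Z_an_eq subadditive_potential.partition_fn_def[OF subadditive_potential_phi_an] ..

lemma mbar_an_pos_eq_crossing_rate:
  assumes "\<beta> \<ge> 0" "h > 0"
  shows "mbar_an_pos M V \<iota> h \<beta> = subadditive_potential.crossing_rate (\<lambda>n. phi_an M V \<beta> (real n)) \<iota> h"
proof -
  interpret \<phi>: subadditive_potential "\<lambda>n. phi_an M V \<beta> (real n)"
    by (rule subadditive_potential_phi_an) fact
  \<comment> \<open>At \<open>L = 0\<close> the two sums differ by the term \<open>n = 0\<close>,
    but both quotients are 0 because the divisor is 0.\<close>
  have "ln (\<Sum>n. \<phi>.plane_sum \<iota> h (Suc n) (int L)) / real L = ln (\<phi>.green \<iota> h (int L)) / real L" for L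
    by (cases "L = 0") (simp_all add: \<phi>.green_Suc assms)
  then show ?thesis
    unfolding mbar_an_pos_def \<phi>.crossing_rate_def integral_plane \<phi>.plane_sum_def by (simp only:)
qed

lemma mbar_an_0_eq:
  assumes "\<beta> \<ge> 0"
  shows "mbar_an M V \<iota> 0 \<beta> =
    (INF h\<in>{0<..}. subadditive_potential.crossing_rate (\<lambda>n. phi_an M V \<beta> (real n)) \<iota> h + h)"
proof -
  interpret \<phi>: subadditive_potential "\<lambda>n. phi_an M V \<beta> (real n)"
    by (rule subadditive_potential_phi_an) fact
  have "eventually (\<lambda>h. \<phi>.crossing_rate \<iota> h = mbar_an_pos M V \<iota> h \<beta>) (at_right 0)"
    using eventually_at_right_less[of 0] by eventually_elim (simp add: mbar_an_pos_eq_crossing_rate assms)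
  then have "((\<lambda>h. mbar_an_pos M V \<iota> h \<beta>) \<longlongrightarrow> (INF h\<in>{0<..}. \<phi>.crossing_rate \<iota> h + h)) (at_right 0)"
    using \<phi>.crossing_rate_tendsto_at_0[of \<iota>] by (rule Lim_transform_eventually[rotated])
  then show ?thesis
    by (simp add: mbar_an_def tendsto_Lim)
qed

lemma Z_an_le_exp_m_an:
  assumes "\<beta> \<ge> 0"
  shows "Z_an M V \<iota> h \<beta> N \<le> exp (- m_an M V \<iota> h \<beta> * real N)"
proof -
  interpret \<phi>: subadditive_potential "\<lambda>n. phi_an M V \<beta> (real n)"
    by (rule subadditive_potential_phi_an) fact
  obtain m where m: "(\<lambda>N. ln (\<phi>.partition_fn \<iota> h N) / real N) \<longlonglongrightarrow> - m"
    "\<And>N. \<phi>.partition_fn \<iota> h N \<le> exp (- m * real N)"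
    using \<phi>.partition_limit by blast
  then have "m_an M V \<iota> h \<beta> = m"
    using assms by (simp add: m_an_def Z_an_eq_partition limI)
  then show ?thesis using m(2) assms by (simp add: Z_an_eq_partition)
qed

lemma exp_m_an_gt_return_ratio:
  assumes "h > 0" "is_beta_c_an M V \<iota> h \<beta>\<^sub>c" "0 \<le> \<beta>" "\<beta> < \<beta>\<^sub>c"
  shows "step_norm \<iota> 0 / step_norm \<iota> h < exp (- m_an M V \<iota> h \<beta>)"
proof (cases "\<beta> = 0")
  \<comment> \<open>Zero is treated apart because the uniqueness in \<open>is_beta_c_an\<close>
    concerns positive parameters only.\<close>
  case True
  have "Z_an M V \<iota> h \<beta> N = 1" for N
    using path_sum_one by (simp add: True Z_an_eq phi_an_eq energy_def)
  then have "m_an M V \<iota> h \<beta> = 0" by (simp add: m_an_def limI)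
  then show ?thesis
    using step_norm_strict_mono[of 0 h \<iota>] assms by (simp add: step_norm_pos)
next
  case False
  let ?\<phi> = "\<lambda>\<beta> n. phi_an M V \<beta> (real n)"
  interpret \<phi>: subadditive_potential "?\<phi> \<beta>"
    by (rule subadditive_potential_phi_an) fact
  interpret \<psi>: subadditive_potential "?\<phi> \<beta>\<^sub>c"
    by (rule subadditive_potential_phi_an) (use assms in simp)
  have bdd: "bdd_below ((\<lambda>h. \<phi>.crossing_rate \<iota> h + h) ` {0<..})"
    using \<phi>.crossing_rate_ge[of _ \<iota>] by (intro bdd_belowI[where m = 0]) fastforce
  have "(INF h\<in>{0<..}. \<phi>.crossing_rate \<iota> h + h) \<le> (INF h\<in>{0<..}. \<psi>.crossing_rate \<iota> h + h)"
  proof (rule cINF_mono)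
    fix h :: real assume h: "h \<in> {0<..}"
    have "\<phi>.crossing_rate \<iota> h \<le> \<psi>.crossing_rate \<iota> h"
      by (rule crossing_rate_mono_potential) (use h assms in
        \<open>auto intro: phi_an_mono \<phi>.subadditive_potential_axioms \<psi>.subadditive_potential_axioms\<close>)
    then show "\<exists>h'\<in>{0<..}. \<phi>.crossing_rate \<iota> h' + h' \<le> \<psi>.crossing_rate \<iota> h + h"
      using h by (intro bexI[of _ h]) auto
  qed (use bdd in auto)
  then have "mbar_an M V \<iota> 0 \<beta> \<le> mbar_an M V \<iota> 0 \<beta>\<^sub>c"
    using assms by (simp add: mbar_an_0_eq)
  \<comment> \<open>Equality at \<open>\<beta>\<close> would contradict the uniqueness of
    \<open>\<beta>\<^sub>c\<close>, so the monotonicity bound becomes strict.\<close>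
  moreover have "mbar_an M V \<iota> 0 \<beta>\<^sub>c = h" "mbar_an M V \<iota> 0 \<beta> \<noteq> h"
    using assms False unfolding is_beta_c_an_def
    by (simp, metis less_eq_real_def less_irrefl)
  ultimately have "(INF h\<in>{0<..}. \<phi>.crossing_rate \<iota> h + h) < h"
    using assms by (simp add: mbar_an_0_eq)
  then obtain h' where "0 < h'" "\<phi>.crossing_rate \<iota> h' + h' < h"
    using bdd by (subst (asm) cINF_less_iff) auto
  then show ?thesis
    by (rule \<phi>.rate_less_if_crossing_rate_less)
       (use Z_an_le_exp_m_an[OF \<open>0 \<le> \<beta>\<close>] in \<open>simp add: Z_an_eq_partition[OF \<open>0 \<le> \<beta>\<close>]\<close>)
qed

end

theorem lemmaE:
  fixes M :: "'a measure"
    and V :: "int ^ 'd::finite \<Rightarrow> 'a \<Rightarrow> real"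
    and \<iota> :: 'd
    and h \<beta>\<^sub>0 \<beta>\<^sub>c K \<epsilon> :: real
  assumes "prob_space M"
    and "prob_space.indep_vars M (\<lambda>_. borel) V UNIV"
    and "\<And>x. distr M borel (V x) = distr M borel (V 0)"
    and "\<And>x. ess_inf M (V x) = 0"
    and "\<And>x. integrable M (\<lambda>\<omega>. V x \<omega> ^ CARD('d))"
    and "\<And>x. measure M {\<omega> \<in> space M. V x \<omega> = 0} < 1"
    and "h > 0"
    and "is_beta_c_an M V \<iota> h \<beta>\<^sub>c"
    and "0 \<le> \<beta>\<^sub>0" and "\<beta>\<^sub>0 < \<beta>\<^sub>c"
    and "\<And>N \<beta>. N \<ge> 1 \<Longrightarrow> 0 \<le> \<beta> \<Longrightarrow> \<beta> \<le> \<beta>\<^sub>0 \<Longrightarrow>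
           Z_an M V \<iota> h \<beta> N \<ge> exp (- m_an M V \<iota> h \<beta> * real N) / K"
    and "\<epsilon> < 1 / K"
  shows "\<exists>k\<ge>0. \<forall>N\<ge>1. \<forall>\<beta>. 0 \<le> \<beta> \<and> \<beta> \<le> \<beta>\<^sub>0 \<longrightarrow>
           (LINT \<omega>|M. Z_qu \<iota> (\<lambda>x. V x \<omega>) h \<beta> k N) \<ge> \<epsilon> * Z_an M V \<iota> h \<beta> N"
proof -
  interpret prob_space M by fact
  interpret iid_nonneg_potential M V
    by unfold_locales (use assms(2,3,4) AE_nonneg_of_ess_inf in \<open>auto\<close>)
  show ?thesis
  proof (cases "K > 0")
    case False
    \<comment> \<open>This covers \<open>K = 0\<close>, where \<open>1 / K\<close> is 0. With a
      nonpositive left side, \<open>k = 0\<close> suffices.\<close>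
    then have "\<epsilon> \<le> 0" using \<open>\<epsilon> < 1 / K\<close> by (smt (verit) divide_nonneg_nonpos)
    have "\<epsilon> * Z_an M V \<iota> h \<beta> N \<le> (LINT \<omega>|M. Z_qu \<iota> (\<lambda>x. V x \<omega>) h \<beta> 0 N)" if "0 \<le> \<beta>" for \<beta> N
    proof -
      have "\<epsilon> * Z_an M V \<iota> h \<beta> N \<le> 0"
        using \<open>\<epsilon> \<le> 0\<close> unfolding Z_an_eq by (intro mult_nonpos_nonneg path_sum_nonneg) auto
      also have "0 \<le> (LINT \<omega>|M. Z_qu \<iota> (\<lambda>x. V x \<omega>) h \<beta> 0 N)"
        unfolding integral_Z_qu[OF that] by (intro path_sum_nonneg) auto
      finally show ?thesis .
    qed
    then show ?thesis by (intro exI[of _ 0]) auto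
  next
    case True
    \<comment> \<open>The lower bound at \<open>\<beta>\<^sub>0\<close> serves for every smaller
      \<open>\<beta>\<close>, since \<open>Z_an\<close> does not increase in \<open>\<beta>\<close>.
      This makes \<open>k\<close> independent of \<open>\<beta>\<close>.\<close>
    define s where "s = exp (- m_an M V \<iota> h \<beta>\<^sub>0)"
    have s: "s > 0" "step_norm \<iota> 0 / step_norm \<iota> h < s"
      unfolding s_def using exp_m_an_gt_return_ratio assms by auto
    have power: "exp (- m_an M V \<iota> h \<beta>\<^sub>0 * real r) = s ^ r" for r
      unfolding s_def by (subst exp_of_nat2_mult[symmetric]) simp
    \<comment> \<open>Comparing the assumed lower bound with the upper bound at \<open>N = 1\<close>
      forces \<open>K \<ge> 1\<close>, hence \<open>\<epsilon> < 1\<close>.\<close>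
    have "s / K \<le> s"
      using assms(11)[of 1 \<beta>\<^sub>0] Z_an_le_exp_m_an[of \<beta>\<^sub>0 \<iota> h 1] \<open>0 \<le> \<beta>\<^sub>0\<close> by (simp add: s_def)
    then have "K \<ge> 1" using s True by (simp add: field_simps)
    then have "\<epsilon> < 1" using \<open>\<epsilon> < 1 / K\<close> by (smt (verit) divide_le_eq_1_pos)
    define k where "k = 2 / (1 / K * (1 - step_norm \<iota> 0 / step_norm \<iota> h / s)) / (1 - \<epsilon>)"
    have "step_norm \<iota> 0 / step_norm \<iota> h / s < 1"
      using s by (simp only: pos_divide_less_eq mult_1)
    then have "k \<ge> 0"
      unfolding k_def using True \<open>\<epsilon> < 1\<close> by (intro divide_nonneg_nonneg mult_nonneg_nonneg) auto
    moreover have "\<epsilon> * Z_an M V \<iota> h \<beta> N \<le> (LINT \<omega>|M. Z_qu \<iota> (\<lambda>x. V x \<omega>) h \<beta> k N)"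
      if "N \<ge> 1" "0 \<le> \<beta>" "\<beta> \<le> \<beta>\<^sub>0" for N \<beta>
    proof -
      interpret \<phi>: subadditive_potential "\<lambda>n. phi_an M V \<beta> (real n)"
        by (rule subadditive_potential_phi_an) fact
      have lower: "1 / K * s ^ r \<le> \<phi>.partition_fn \<iota> h r" for r
      proof (cases "r \<ge> 1")
        case True
        have "1 / K * s ^ r \<le> Z_an M V \<iota> h \<beta>\<^sub>0 r"
          using assms(11)[of r \<beta>\<^sub>0] True \<open>0 \<le> \<beta>\<^sub>0\<close> unfolding power by simp
        also have "\<dots> \<le> Z_an M V \<iota> h \<beta> r"
          unfolding Z_an_eq_partition[OF \<open>0 \<le> \<beta>\<close>] Z_an_eq_partition[OF \<open>0 \<le> \<beta>\<^sub>0\<close>]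
          by (intro partition_antimono_potential subadditive_potential_phi_an phi_an_mono that \<open>0 \<le> \<beta>\<^sub>0\<close>)
        finally show ?thesis using that by (simp add: Z_an_eq_partition)
      next
        \<comment> \<open>The assumed bound starts at length 1; at length 0 the partition function
          is 1 and \<open>K \<ge> 1\<close> suffices.\<close>
        case False
        then have "r = 0" by simp
        then show ?thesis using \<open>K \<ge> 1\<close> by simp
      qed
      show ?thesis
        unfolding integral_Z_qu[OF \<open>0 \<le> \<beta>\<close>] Z_an_eq_partition[OF \<open>0 \<le> \<beta>\<close>] k_def
        using s True lower \<open>\<epsilon> < 1\<close> \<open>N \<ge> 1\<close>
        by (intro \<phi>.path_sum_energy_square_bounded_ge) auto
    qed
    ultimately show ?thesis by auto
  qed
qed

end
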